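(* Let $(I,J)\in\mathfrak{S}_{n,k}$ be a partial permutation of $[n]$ of size $k$, and write the atomic symmetric function in the Schur basis as $A_{n,I,J}=\sum_{\lambda\vdash n} b_\lambda s_\lambda$. Then $b_\lambda=0$ unless $\lambda_1\ge n-k$.
   Context: A partial permutation of size $k$ of $[n]$ is a pair $(I,J)$ of length-$k$ sequences $I=(i_1,\dots,i_k)$, $J=(j_1,\dots,j_k)$, each consisting of distinct elements of $[n]$ (up to simultaneous permutation of entries); $\mathfrak{S}_{n,k}$ is the set of these. For $w\in\mathfrak{S}_n$ write $w(I)=J$ if $w(i_t)=j_t$ for all $t$. The atomic symmetric function is $A_{n,I,J}=\sum_{\lambda\vdash n} a_\lambda p_\lambda$, where $a_\lambda$ is the number of permutations $w\in\mathfrak{S}_n$ of cycle type $\lambda$ with $w(I)=J$ and $p_\lambda$ is a power sum symmetric function; $s_\lambda$ denotes the Schur function. *)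

theory Defs
  imports
    "HOL-Library.Poly_Mapping"
    "HOL-Library.Multiset"
    "HOL-Library.FuncSet"
    "HOL-Combinatorics.Combinatorics"
begin

section \<open>Formal power series in countably many variables\<close>

text \<open>
  Symmetric functions are formal power series in countably many variables. The variables are
  indexed by the natural numbers, a monomial is its exponent vector, which is finitely supported,
  and a power series is its coefficient function on monomials.
\<close>

typedef 'a mfps = "UNIV :: ((nat \<Rightarrow>\<^sub>0 nat) \<Rightarrow> 'a) set"
  morphisms mcoeff Abs_mfps ..

setup_lifting type_definition_mfps

lemma mfps_eqI: "(\<And>m. mcoeff f m = mcoeff g m) \<Longrightarrow> f = g"
  by (metis ext mcoeff_inject)

definition splits :: "(nat \<Rightarrow>\<^sub>0 nat) \<Rightarrow> ((nat \<Rightarrow>\<^sub>0 nat) \<times> (nat \<Rightarrow>\<^sub>0 nat)) set" where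
  "splits m = {(a, b). a + b = m}"

lemma finite_splits: "finite (splits m)"
proof -
  let ?S = "{f. \<forall>x. (x \<in> Poly_Mapping.keys m \<longrightarrow> f x \<in> {..Max (Poly_Mapping.lookup m ` Poly_Mapping.keys m)}) \<and>
                 (x \<notin> Poly_Mapping.keys m \<longrightarrow> f x = (0::nat))}"
  let ?g = "\<lambda>(a, b). (Poly_Mapping.lookup a, Poly_Mapping.lookup b)"
  have "finite ?S"
    by (rule finite_set_of_finite_funs) (auto simp: Poly_Mapping.finite_keys)
  have le: "Poly_Mapping.lookup a \<in> ?S" if "\<And>x. Poly_Mapping.lookup a x \<le> Poly_Mapping.lookup m x" for a
  proof -
    have "Poly_Mapping.lookup a x \<le> Max (Poly_Mapping.lookup m ` Poly_Mapping.keys m)" if "x \<in> Poly_Mapping.keys m" for x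
      using \<open>\<And>x. Poly_Mapping.lookup a x \<le> Poly_Mapping.lookup m x\<close>[of x] that
      by (meson Max_ge finite_imageI Poly_Mapping.finite_keys image_eqI le_trans)
    moreover have "Poly_Mapping.lookup a x = 0" if "x \<notin> Poly_Mapping.keys m" for x
      using \<open>\<And>x. Poly_Mapping.lookup a x \<le> Poly_Mapping.lookup m x\<close>[of x] that by (simp add: Poly_Mapping.in_keys_iff)
    ultimately show ?thesis by auto
  qed
  have "?g ` splits m \<subseteq> ?S \<times> ?S"
  proof
    fix z assume "z \<in> ?g ` splits m"
    then obtain a b where ab: "a + b = m" "z = (Poly_Mapping.lookup a, Poly_Mapping.lookup b)"
      by (auto simp: splits_def)
    have "Poly_Mapping.lookup a \<in> ?S"
      by (rule le) (use ab in \<open>auto simp: Poly_Mapping.lookup_add\<close>)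
    moreover have "Poly_Mapping.lookup b \<in> ?S"
      by (rule le) (use ab in \<open>auto simp: Poly_Mapping.lookup_add\<close>)
    ultimately
    show "z \<in> ?S \<times> ?S" using ab(2) by blast
  qed
  then have "finite (?g ` splits m)"
    using \<open>finite ?S\<close> finite_subset by blast
  moreover have "inj_on ?g (splits m)"
    by (auto simp: inj_on_def Poly_Mapping.poly_mapping.lookup_inject)
  ultimately show ?thesis
    by (rule finite_imageD)
qed

instantiation mfps :: (comm_ring_1) comm_ring_1
begin

lift_definition zero_mfps :: "'a mfps" is "\<lambda>_. 0" .
lift_definition one_mfps :: "'a mfps" is "\<lambda>m. if m = 0 then 1 else 0" .
lift_definition plus_mfps :: "'a mfps \<Rightarrow> 'a mfps \<Rightarrow> 'a mfps" is "\<lambda>f g m. f m + g m" .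
lift_definition minus_mfps :: "'a mfps \<Rightarrow> 'a mfps \<Rightarrow> 'a mfps" is "\<lambda>f g m. f m - g m" .
lift_definition uminus_mfps :: "'a mfps \<Rightarrow> 'a mfps" is "\<lambda>f m. - f m" .
lift_definition times_mfps :: "'a mfps \<Rightarrow> 'a mfps \<Rightarrow> 'a mfps"
  is "\<lambda>f g m. \<Sum>(a, b)\<in>splits m. f a * g b" .

instance
proof
  fix f g h :: "'a mfps"
  show "f * g * h = f * (g * h)"
  proof (rule mfps_eqI)
    fix m
    let ?L = "SIGMA z:splits m. splits (fst z)"
    let ?R = "SIGMA z:splits m. splits (snd z)"
    have "mcoeff (f * g * h) m
            = (\<Sum>(z, y)\<in>?L. mcoeff f (fst y) * mcoeff g (snd y) * mcoeff h (snd z))"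
      by (simp add: times_mfps.rep_eq sum_distrib_right case_prod_unfold
          sum.Sigma[OF finite_splits, simplified] finite_splits)
    also have "\<dots> = (\<Sum>(z, y)\<in>?R. mcoeff f (fst z) * mcoeff g (fst y) * mcoeff h (snd y))"
      by (rule sum.reindex_bij_witness[where
            i = "\<lambda>(z, y). ((fst z + fst y, snd y), (fst z, fst y))" and
            j = "\<lambda>(z, y). ((fst y, snd y + snd z), (snd y, snd z))"])
        (auto simp: splits_def add.assoc)
    also have "\<dots> = mcoeff (f * (g * h)) m"
      by (simp add: times_mfps.rep_eq sum_distrib_left case_prod_unfold mult.assoc
          sum.Sigma[OF finite_splits, simplified] finite_splits)
    finally show "mcoeff (f * g * h) m = mcoeff (f * (g * h)) m" .
  qed
  show "f * g = g * f"
  proof (rule mfps_eqI)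
    fix m
    show "mcoeff (f * g) m = mcoeff (g * f) m"
      unfolding times_mfps.rep_eq
      by (rule sum.reindex_bij_witness[where i = prod.swap and j = prod.swap])
        (auto simp: splits_def add.commute mult.commute)
  qed
  show "1 * f = f"
  proof (rule mfps_eqI)
    fix m
    have "mcoeff (1 * f) m = (\<Sum>z\<in>splits m. if z = (0, m) then mcoeff f m else 0)"
      unfolding times_mfps.rep_eq one_mfps.rep_eq
      by (rule sum.cong) (auto simp: splits_def split: if_splits)
    also have "\<dots> = mcoeff f m"
      by (simp add: finite_splits) (simp add: splits_def)
    finally show "mcoeff (1 * f) m = mcoeff f m" .
  qed
  show "(f + g) * h = f * h + g * h"
    by (rule mfps_eqI)
      (simp add: times_mfps.rep_eq plus_mfps.rep_eq distrib_right sum.distrib case_prod_unfold)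
  show "(0::'a mfps) \<noteq> 1"
    by transfer (auto simp: fun_eq_iff)
qed (rule mfps_eqI; simp add: plus_mfps.rep_eq minus_mfps.rep_eq uminus_mfps.rep_eq
    zero_mfps.rep_eq ac_simps)+

end

lift_definition mfps_const :: "'a::zero \<Rightarrow> 'a mfps" is "\<lambda>c m. if m = 0 then c else 0" .

lemma mcoeff_const_mult: "mcoeff (mfps_const c * f) m = c * mcoeff f m"
proof -
  have "mcoeff (mfps_const c * f) m = (\<Sum>z\<in>splits m. if z = (0, m) then c * mcoeff f m else 0)"
    unfolding times_mfps.rep_eq mfps_const.rep_eq
    by (rule sum.cong) (auto simp: splits_def split: if_splits)
  also have "\<dots> = c * mcoeff f m"
    by (simp add: finite_splits) (simp add: splits_def)
  finally show ?thesis .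
qed


section \<open>Partitions, power sums and Schur functions\<close>

definition int_partitions :: "nat \<Rightarrow> nat list set" where
  "int_partitions n = {\<mu>. sorted_wrt (\<ge>) \<mu> \<and> 0 \<notin> set \<mu> \<and> sum_list \<mu> = n}"

lemma finite_int_partitions: "finite (int_partitions n)"
proof (rule finite_subset)
  have len: "length xs \<le> sum_list xs" if "0 \<notin> set xs" for xs :: "nat list"
    using that by (induction xs) (auto simp: Suc_le_eq intro: add_less_le_mono)
  show "int_partitions n \<subseteq> {xs. set xs \<subseteq> {..n} \<and> length xs \<le> n}"
    using len member_le_sum_list by (fastforce simp: int_partitions_def)
  show "finite {xs. set xs \<subseteq> {..n} \<and> length xs \<le> n}"
    by (rule finite_lists_length_le) simp
qed

text \<open>The largest part, where the empty partition has largest part \<open>0\<close>.\<close>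

definition first_part :: "nat list \<Rightarrow> nat" where
  "first_part \<mu> = (case \<mu> of [] \<Rightarrow> 0 | x # _ \<Rightarrow> x)"

text \<open>\<open>p\<^sub>r = x\<^sub>0\<^sup>r + x\<^sub>1\<^sup>r + \<dots>\<close>; only used for \<open>r \<ge> 1\<close>.\<close>

lift_definition power_sum :: "nat \<Rightarrow> 'a::comm_ring_1 mfps"
  is "\<lambda>r m. if \<exists>i. m = Poly_Mapping.single i r then 1 else 0" .

definition power_sum_partition :: "nat list \<Rightarrow> 'a::comm_ring_1 mfps" where
  "power_sum_partition \<mu> = (\<Prod>r\<leftarrow>\<mu>. power_sum r)"

definition young_diagram :: "nat list \<Rightarrow> (nat \<times> nat) set" where
  "young_diagram \<mu> = {(i, j). i < length \<mu> \<and> j < \<mu> ! i}"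

lemma finite_young_diagram: "finite (young_diagram \<mu>)"
proof -
  have "young_diagram \<mu> = (SIGMA i:{..<length \<mu>}. {..<\<mu> ! i})"
    by (auto simp: young_diagram_def)
  then show ?thesis by simp
qed

text \<open>
  Semistandard Young tableaux in English notation. The entries are indices of variables, so they
  start from \<open>0\<close> instead of \<open>1\<close>. A tableau is extensional, so that it is determined by its values
  on the diagram and tableaux can be counted.
\<close>

definition semistandard_tableaux :: "nat list \<Rightarrow> (nat \<times> nat \<Rightarrow> nat) set" where
  "semistandard_tableaux \<mu> = {T \<in> extensional (young_diagram \<mu>).
     (\<forall>i j j'. (i, j) \<in> young_diagram \<mu> \<and> (i, j') \<in> young_diagram \<mu> \<and> j < j'
         \<longrightarrow> T (i, j) \<le> T (i, j')) \<and>
     (\<forall>i i' j. (i, j) \<in> young_diagram \<mu> \<and> (i', j) \<in> young_diagram \<mu> \<and> i < i'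
         \<longrightarrow> T (i, j) < T (i', j))}"

definition tableau_content :: "nat list \<Rightarrow> (nat \<times> nat \<Rightarrow> nat) \<Rightarrow> (nat \<Rightarrow>\<^sub>0 nat)" where
  "tableau_content \<mu> T = (\<Sum>c\<in>young_diagram \<mu>. Poly_Mapping.single (T c) 1)"

lemma finite_tableaux_content:
  "finite {T \<in> semistandard_tableaux \<mu>. tableau_content \<mu> T = m}"
proof (rule finite_subset)
  show "{T \<in> semistandard_tableaux \<mu>. tableau_content \<mu> T = m}
          \<subseteq> (\<Pi>\<^sub>E c\<in>young_diagram \<mu>. Poly_Mapping.keys m)"
  proof (clarify, rule PiE_I)
    fix T c
    assume T: "T \<in> semistandard_tableaux \<mu>" and m: "m = tableau_content \<mu> T"
    assume c: "c \<in> young_diagram \<mu>"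
    have "Poly_Mapping.lookup m (T c) = (\<Sum>d\<in>young_diagram \<mu>. Poly_Mapping.lookup (Poly_Mapping.single (T d) (1::nat)) (T c))"
      unfolding m tableau_content_def
      by (simp add: Poly_Mapping.lookup_sum)
    also have "\<dots> \<ge> Poly_Mapping.lookup (Poly_Mapping.single (T c) (1::nat)) (T c)"
      by (rule member_le_sum) (use c finite_young_diagram in auto)
    finally show "T c \<in> Poly_Mapping.keys (tableau_content \<mu> T)"
      unfolding m by (simp add: Poly_Mapping.in_keys_iff)
  next
    fix T c
    assume "T \<in> semistandard_tableaux \<mu>" "c \<notin> young_diagram \<mu>"
    then show "T c = undefined"
      by (cases c) (simp add: semistandard_tableaux_def extensional_def)
  qed
  show "finite (\<Pi>\<^sub>E c\<in>young_diagram \<mu>. Poly_Mapping.keys m)"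
    by (rule finite_PiE[OF finite_young_diagram]) simp
qed

text \<open>\<open>s\<^sub>\<mu> = \<Sum>\<^sub>T x\<^sup>T\<close>, summed over the semistandard tableaux \<open>T\<close> of shape \<open>\<mu>\<close>.\<close>

lift_definition schur :: "nat list \<Rightarrow> 'a::comm_ring_1 mfps"
  is "\<lambda>\<mu> m. of_nat (card {T \<in> semistandard_tableaux \<mu>. tableau_content \<mu> T = m})" .


section \<open>Partial permutations and atomic symmetric functions\<close>

text \<open>
  A partial permutation is a pair of sequences up to simultaneous permutation of the entries. It is
  represented here by any of its pairs of sequences; \<open>atomic\<close> is the same for all of them.
\<close>

definition partial_permutations :: "nat \<Rightarrow> nat \<Rightarrow> (nat list \<times> nat list) set" where
  "partial_permutations n k = {(I, J). length I = k \<and> length J = k \<and> distinct I \<and> distinct J \<and>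
     set I \<subseteq> {1..n} \<and> set J \<subseteq> {1..n}}"

definition cycle_type :: "nat \<Rightarrow> (nat \<Rightarrow> nat) \<Rightarrow> nat list" where
  "cycle_type n w = rev (sorted_list_of_multiset (image_mset card (mset_set (orbit w ` {1..n}))))"

definition atomic :: "nat \<Rightarrow> nat list \<Rightarrow> nat list \<Rightarrow> 'a::comm_ring_1 mfps" where
  "atomic n I J = (\<Sum>\<mu>\<in>int_partitions n.
     of_nat (card {w. w permutes {1..n} \<and> cycle_type n w = \<mu> \<and> map w I = J}) *
     power_sum_partition \<mu>)"

end

theory Submission
  imports Defs "Jordan_Normal_Form.Determinant"
begin

text \<open>
  Restrict to \<open>N = n\<close> variables and write \<open>a\<^sub>\<gamma> = det (x\<^sub>j\<^bsup>\<gamma>\<^sub>i\<^esup>)\<close>. By the bialternant formula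
  \<open>a\<^sub>\<delta> s\<^sub>\<mu> = a\<^bsub>\<mu>+\<delta>\<^esub>\<close>, the number \<open>b\<^sub>\<mu>\<close> is the coefficient of \<open>x\<^bsup>\<mu>+\<delta>\<^esup>\<close> in \<open>a\<^sub>\<delta> A\<close>, so it suffices
  that \<open>a\<^sub>\<delta> A\<close> lies in the ideal generated by the powers \<open>x\<^sub>v\<^sup>K\<close> with \<open>K = m + N - 1\<close> and \<open>m = n - k\<close>.

  Merging the points along the arrows of the partial permutation turns its cycles into factors
  \<open>p\<^sub>r\<close>, which are harmless, and its \<open>m\<close> paths into weighted points without constraints. For these,
  \<open>A = \<Sum>\<^sub>c \<Prod>\<^sub>v |c\<^sup>-\<^sup>1(v)|! \<Prod>\<^sub>i x\<^bsub>c i\<^esub>\<^bsup>\<mu> i\<^esup>\<close> over all colourings \<open>c\<close> of the points, so \<open>a\<^sub>\<delta> A\<close> is a signed sum over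
  ways to stack \<open>m\<close> blocks on \<open>N\<close> bases of heights \<open>0, \<dots>, N - 1\<close>. If no stack exceeds the height
  \<open>K - 1\<close>, two of the \<open>N + m\<close> tops of bases and blocks have the same height, and exchanging what
  lies above them changes the sign. For fixed heights of all the tops, the signed sum is a
  determinant with two equal rows.
\<close>

section \<open>Stackings of blocks\<close>

text \<open>
  The ideal generated by \<open>x\<^sub>v\<^sup>K\<close> for \<open>v < N\<close>. With \<open>K = m + N - 1\<close> it detects a first part of length at least
  \<open>m\<close>: this is the largest exponent in the alternant of a partition with first part \<open>m\<close>.
\<close>

definition pow_ideal :: "nat \<Rightarrow> nat \<Rightarrow> (nat \<Rightarrow> 'r::comm_ring_1) \<Rightarrow> 'r set" where
  "pow_ideal N K x = {y. \<exists>g. y = (\<Sum>v<N. x v ^ K * g v)}"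

lemma pow_idealI: "y = (\<Sum>v<N. x v ^ K * g v) \<Longrightarrow> y \<in> pow_ideal N K x"
  unfolding pow_ideal_def by (rule CollectI, rule exI[of _ g])

lemma pow_ideal_0: "0 \<in> pow_ideal N K x"
  by (rule pow_idealI[where g = "\<lambda>_. 0"]) simp

lemma pow_ideal_add: "y \<in> pow_ideal N K x \<Longrightarrow> z \<in> pow_ideal N K x \<Longrightarrow> y + z \<in> pow_ideal N K x"
proof -
  assume "y \<in> pow_ideal N K x" "z \<in> pow_ideal N K x"
  then obtain g h where "y = (\<Sum>v<N. x v ^ K * g v)" "z = (\<Sum>v<N. x v ^ K * h v)"
    by (auto simp: pow_ideal_def)
  then have "y + z = (\<Sum>v<N. x v ^ K * (g v + h v))"
    by (simp add: sum.distrib distrib_left)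
  then show ?thesis by (rule pow_idealI)
qed

lemma pow_ideal_mult: "y \<in> pow_ideal N K x \<Longrightarrow> z * y \<in> pow_ideal N K x"
proof -
  assume "y \<in> pow_ideal N K x"
  then obtain g where "y = (\<Sum>v<N. x v ^ K * g v)"
    by (auto simp: pow_ideal_def)
  then have "z * y = (\<Sum>v<N. x v ^ K * (z * g v))"
    by (simp add: sum_distrib_left mult_ac)
  then show ?thesis by (rule pow_idealI)
qed

lemma pow_ideal_sum: "(\<And>i. i \<in> A \<Longrightarrow> f i \<in> pow_ideal N K x) \<Longrightarrow> sum f A \<in> pow_ideal N K x"
proof (induction A rule: infinite_finite_induct)
  case (insert i A)
  have "f i + sum f A \<in> pow_ideal N K x"
    by (intro pow_ideal_add insert.prems insert.IH insertI1 insertI2)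
  with insert.hyps show ?case by simp
qed (simp_all add: pow_ideal_0)

lemma pow_ideal_power: "v < N \<Longrightarrow> K \<le> k \<Longrightarrow> x v ^ k \<in> pow_ideal N K x"
proof -
  assume "v < N" "K \<le> k"
  then have "x v ^ k = (\<Sum>u<N. if u = v then x u ^ K * x u ^ (k - K) else 0)"
    by (simp flip: power_add)
  also have "\<dots> = (\<Sum>u<N. x u ^ K * (if u = v then x u ^ (k - K) else 0))"
    by (intro sum.cong) auto
  finally show ?thesis by (rule pow_idealI)
qed

section \<open>Determinants that count stackings with signs\<close>

definition alternant :: "nat \<Rightarrow> (nat \<Rightarrow> 'r::comm_ring_1) \<Rightarrow> (nat \<Rightarrow> nat) \<Rightarrow> 'r" where
  "alternant N x \<gamma> = det (mat N N (\<lambda>(i, j). x j ^ \<gamma> i))"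

text \<open>
  Up to sign, the right-hand side is the row \<open>r\<close> times the adjugate of \<open>a\<close> times the column \<open>u\<close>.
\<close>

lemma det_bordered:
  fixes a :: "nat \<Rightarrow> nat \<Rightarrow> 'r::comm_ring_1"
  shows "det (mat (Suc n) (Suc n) (\<lambda>(i, j). if i < n then if j < n then a i j else u i
           else if j < n then r j else 0))
       = - (\<Sum>i<n. \<Sum>j<n. u i * r j * cofactor (mat n n (\<lambda>(i, j). a i j)) i j)" (is "det ?B = _")
proof (cases "n = 0")
  case True
  then show ?thesis by (simp add: det_single)
next
  case False
  let ?A = "mat n n (\<lambda>(i, j). a i j)"
  \<comment> \<open>The expansion starts with the last column of \<open>?B\<close>; the minors that
    remain keep \<open>r\<close> as their last row.\<close>
  have cof: "cofactor ?B i n = - (\<Sum>j<n. r j * cofactor ?A i j)" if i: "i < n" for i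
  proof -
    let ?D = "mat_delete ?B i n"
    have D: "?D \<in> carrier_mat n n"
      using mat_delete_carrier[of ?B "Suc n" "Suc n"] by simp
    have last: "?D $$ (n - 1, j) = r j" if "j < n" for j
      using that i by (auto simp: mat_delete_def)
    have del: "mat_delete ?D (n - 1) j = mat_delete ?A i j" if "j < n" for j
      using that i by (intro eq_matI) (auto simp: mat_delete_def)
    \<comment> \<open>The bordering row has index \<open>n - 1\<close> in \<open>?D\<close>, but the
      deleted column has index \<open>n\<close> in \<open>?B\<close>. This shift by one is the
      source of the minus sign.\<close>
    have sign: "(-1) ^ (i + n) * (-1) ^ (n - 1 + j) = - ((-1) ^ (i + j) :: 'r)" for j
    proof -
      have "i + n + (n - 1 + j) = Suc (i + j + 2 * (n - 1))"
        using False by simp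
      then show ?thesis
        by (simp only: power_add[symmetric]) (simp add: power_add power_mult)
    qed
    have "det ?D = (\<Sum>j<n. r j * cofactor ?D (n - 1) j)"
      using laplace_expansion_row[OF D, of "n - 1"] False last by simp
    also have "\<dots> = (\<Sum>j<n. r j * ((-1) ^ (n - 1 + j) * det (mat_delete ?A i j)))"
      by (intro sum.cong refl) (simp only: cofactor_def del lessThan_iff)
    finally have "cofactor ?B i n
      = (\<Sum>j<n. r j * (((-1) ^ (i + n) * (-1) ^ (n - 1 + j)) * det (mat_delete ?A i j)))"
      by (simp add: cofactor_def sum_distrib_left mult_ac)
    also have "\<dots> = (\<Sum>j<n. r j * (- ((-1) ^ (i + j)) * det (mat_delete ?A i j)))"
      by (simp only: sign)
    finally show ?thesis
      by (simp add: cofactor_def sum_negf mult_ac)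
  qed
  have "det ?B = (\<Sum>i<Suc n. ?B $$ (i, n) * cofactor ?B i n)"
    by (rule laplace_expansion_column) auto
  also have "\<dots> = (\<Sum>i<n. u i * cofactor ?B i n)"
    by simp
  finally show ?thesis
    by (simp add: cof sum_negf sum_distrib_left mult.assoc)
qed

text \<open>
  A term of the determinant encodes \<open>N\<close> stacks. Index \<open>e < N\<close> stands for a stack base of height
  \<open>e\<close>, index \<open>e \<ge> N\<close> for a block of length \<open>\<mu> e\<close>, and \<open>H e\<close> is the height of the top of \<open>e\<close>. The
  permutation sends \<open>e\<close> either to the block placed on it or, if \<open>e\<close> is on top, to the variable of
  its stack.
\<close>

definition height_matrix ::
  "nat \<Rightarrow> nat \<Rightarrow> (nat \<Rightarrow> 'r::comm_ring_1) \<Rightarrow> (nat \<Rightarrow> nat) \<Rightarrow> (nat \<Rightarrow> nat) \<Rightarrow> 'r mat" where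
  "height_matrix N n x \<mu> H =
     mat n n (\<lambda>(e, c). if c < N then x c ^ H e else of_bool (H c = H e + \<mu> c))"

definition heights :: "nat \<Rightarrow> nat \<Rightarrow> nat \<Rightarrow> (nat \<Rightarrow> nat) set" where
  "heights N K n = (\<Pi>\<^sub>E e\<in>{..<n}. if e < N then {e} else {..<K})"

definition height_sum ::
  "nat \<Rightarrow> nat \<Rightarrow> nat \<Rightarrow> (nat \<Rightarrow> 'r::comm_ring_1) \<Rightarrow> (nat \<Rightarrow> nat) \<Rightarrow> 'r" where
  "height_sum N K n x \<mu> = (\<Sum>H\<in>heights N K n. det (height_matrix N n x \<mu> H))"

text \<open>Without blocks every height is forced, and the bases alone give the Vandermonde
  determinant.\<close>

lemma height_sum_base: "height_sum N K N x \<mu> = alternant N x (\<lambda>i. i)"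
proof -
  have "heights N K N = (\<Pi>\<^sub>E e\<in>{..<N}. {restrict (\<lambda>e. e) {..<N} e})"
    unfolding heights_def by (rule PiE_cong) simp
  also have "\<dots> = {restrict (\<lambda>e. e) {..<N}}"
    by (rule PiE_singleton) (rule restrict_extensional)
  finally show ?thesis
    unfolding height_sum_def alternant_def
    by (auto simp: height_matrix_def intro!: arg_cong[of _ _ det] eq_matI)
qed

text \<open>There is one top more than there are heights, so two tops share a height, and row
  \<open>e\<close> of the matrix depends on \<open>e\<close> only through \<open>H e\<close>. The
  hypothesis \<open>N \<le> K\<close> keeps the bases below the bound as well.\<close>

lemma height_sum_pigeonhole:
  assumes "n = Suc K" "N \<le> K"
  shows "height_sum N K n x \<mu> = 0"
  unfolding height_sum_def
proof (rule sum.neutral, rule ballI)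
  fix H assume H: "H \<in> heights N K n"
  have "H e < K" if "e < n" for e
    using PiE_mem[OF H[unfolded heights_def], of e] that assms by (auto split: if_splits)
  then have "H ` {..<n} \<subseteq> {..<K}"
    by auto
  then have "card (H ` {..<n}) \<le> K"
    using card_mono[of "{..<K}" "H ` {..<n}"] by simp
  then have "\<not> inj_on H {..<n}"
    using assms by (auto dest: card_image)
  then obtain d e where de: "d < n" "e < n" "d \<noteq> e" "H d = H e"
    by (auto simp: inj_on_def)
  show "det (height_matrix N n x \<mu> H) = 0"
    by (rule det_identical_rows[of _ n d e]) (use de in \<open>auto simp: height_matrix_def\<close>)
qed

lemma sum_heights_Suc:
  assumes "N \<le> n"
  shows "(\<Sum>H\<in>heights N K (Suc n). f H) = (\<Sum>H\<in>heights N K n. \<Sum>h<K. f (H(n := h)))"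
proof -
  define T where "T = (\<lambda>e. if e < N then {e} else {..<K})"
  have T: "T n = {..<K}" "\<And>m. heights N K m = Pi\<^sub>E {..<m} T"
    using assms by (simp_all add: T_def heights_def)
  have "(\<Sum>H\<in>heights N K (Suc n). f H)
    = (\<Sum>H\<in>(\<lambda>(h, H). H(n := h)) ` (T n \<times> Pi\<^sub>E {..<n} T). f H)"
    by (simp only: T(2) lessThan_Suc PiE_insert_eq)
  also have "\<dots> = (\<Sum>(h, H)\<in>T n \<times> Pi\<^sub>E {..<n} T. f (H(n := h)))"
    by (subst sum.reindex[OF inj_combinator]) (simp_all add: case_prod_unfold)
  also have "\<dots> = (\<Sum>h\<in>T n. \<Sum>H\<in>Pi\<^sub>E {..<n} T. f (H(n := h)))"
    by (rule sum.cartesian_product[symmetric])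
  also have "\<dots> = (\<Sum>H\<in>heights N K n. \<Sum>h<K. f (H(n := h)))"
    unfolding T by (rule sum.swap)
  finally show ?thesis .
qed

text \<open>
  Only modulo the ideal: bounding the heights by \<open>K\<close> drops terms, all of which contain a power
  \<open>x\<^sub>v\<^sup>h\<close> with \<open>h \<ge> K\<close>.
\<close>

lemma height_sum_Suc:
  fixes x :: "nat \<Rightarrow> 'r::comm_ring_1"
  assumes "N \<le> n" "\<mu> n > 0"
  shows "height_sum N K (Suc n) x \<mu>
    + ((\<Sum>v<N. x v ^ \<mu> n) * height_sum N K n x \<mu>
       + (\<Sum>i\<in>{N..<n}. height_sum N K n x (\<mu>(i := \<mu> i + \<mu> n)))) \<in> pow_ideal N K x"
proof -
  define r where "r = \<mu> n"
  define row :: "(nat \<Rightarrow> nat) \<Rightarrow> nat \<Rightarrow> nat \<Rightarrow> 'r" where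
    "row H h c = (if c < N then x c ^ h else of_bool (H c = h + \<mu> c))" for H h c
  define cof where "cof H = cofactor (height_matrix N n x \<mu> H)" for H
  \<comment> \<open>In the expansion along the border, \<open>i\<close> is what the new block
    \<open>n\<close> rests on, which fixes the height of its top to \<open>H i + r\<close>.\<close>
  have step: "(\<Sum>h<K. det (height_matrix N (Suc n) x \<mu> (H(n := h))))
      = - (\<Sum>i<n. \<Sum>j<n. of_bool (H i + r < K) * (row H (H i + r) j * cof H i j))" for H
  proof -
    have "det (height_matrix N (Suc n) x \<mu> (H(n := h)))
      = - (\<Sum>i<n. \<Sum>j<n. of_bool (h = H i + r) * row H h j * cof H i j)" for h
    proof -
      \<comment> \<open>The corner entry is \<open>0\<close> because \<open>\<mu> n > 0\<close>: a
        block never rests on itself.\<close>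
      have "height_matrix N (Suc n) x \<mu> (H(n := h)) =
        mat (Suc n) (Suc n) (\<lambda>(i, j). if i < n then
           if j < n then (if j < N then x j ^ H i else of_bool (H j = H i + \<mu> j))
           else of_bool (h = H i + r)
           else if j < n then row H h j else 0)"
        using assms by (intro eq_matI) (auto simp: height_matrix_def row_def r_def less_Suc_eq)
      then show ?thesis
        by (simp only: det_bordered cof_def height_matrix_def)
    qed
    then have "(\<Sum>h<K. det (height_matrix N (Suc n) x \<mu> (H(n := h))))
      = - (\<Sum>h<K. \<Sum>i<n. \<Sum>j<n. of_bool (h = H i + r) * row H h j * cof H i j)"
      by (simp add: sum_negf)
    also have "(\<Sum>h<K. \<Sum>i<n. \<Sum>j<n. of_bool (h = H i + r) * row H h j * cof H i j)
      = (\<Sum>i<n. \<Sum>h<K. \<Sum>j<n. of_bool (h = H i + r) * row H h j * cof H i j)"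
      by (rule sum.swap)
    also have "\<dots> = (\<Sum>i<n. \<Sum>j<n. \<Sum>h<K. of_bool (h = H i + r) * row H h j * cof H i j)"
      by (intro sum.cong refl sum.swap)
    also have "\<dots> = (\<Sum>i<n. \<Sum>j<n. of_bool (H i + r < K) * (row H (H i + r) j * cof H i j))"
    proof (intro sum.cong refl)
      fix i j
      have "(\<Sum>h<K. of_bool (h = H i + r) * row H h j * cof H i j)
        = (\<Sum>h<K. if h = H i + r then row H h j * cof H i j else 0)"
        by (intro sum.cong) auto
      then show "(\<Sum>h<K. of_bool (h = H i + r) * row H h j * cof H i j)
        = of_bool (H i + r < K) * (row H (H i + r) j * cof H i j)"
        by simp
    qed
    finally show ?thesis .
  qed
  \<comment> \<open>Each column \<open>j\<close> gives a Laplace expansion. For \<open>j < N\<close>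
    the new block is on top of the stack of variable \<open>j\<close>, which gives a factor
    \<open>x j ^ r\<close>. For \<open>j \<ge> N\<close> it carries block \<open>j\<close>, and the
    two merge into one of length \<open>\<mu> j + r\<close>.\<close>
  have full: "(\<Sum>i<n. \<Sum>j<n. row H (H i + r) j * cof H i j)
      = (\<Sum>v<N. x v ^ r) * det (height_matrix N n x \<mu> H)
        + (\<Sum>j\<in>{N..<n}. det (height_matrix N n x (\<mu>(j := \<mu> j + r)) H))" for H
  proof -
    have carr: "height_matrix N n x \<mu>' H \<in> carrier_mat n n" for \<mu>'
      by (simp add: height_matrix_def)
    have 1: "(\<Sum>i<n. row H (H i + r) v * cof H i v) = x v ^ r * det (height_matrix N n x \<mu> H)"
      if "v < N" for v
    proof -
      have "det (height_matrix N n x \<mu> H) = (\<Sum>i<n. x v ^ H i * cof H i v)"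
        using laplace_expansion_column[OF carr, of v \<mu>] that assms(1)
        by (simp add: cof_def height_matrix_def)
      then show ?thesis
        using that by (simp add: row_def power_add sum_distrib_left mult_ac)
    qed
    have 2: "(\<Sum>i<n. row H (H i + r) j * cof H i j) = det (height_matrix N n x (\<mu>(j := \<mu> j + r)) H)"
      if j: "N \<le> j" "j < n" for j
    proof -
      let ?M = "height_matrix N n x (\<mu>(j := \<mu> j + r)) H"
      have "mat_delete ?M i j = mat_delete (height_matrix N n x \<mu> H) i j" for i
        by (intro eq_matI) (auto simp: mat_delete_def height_matrix_def)
      then have "cofactor ?M i j = cof H i j" for i
        by (simp add: cof_def cofactor_def)
      moreover have "?M $$ (i, j) = row H (H i + r) j" if "i < n" for i
        using that j by (simp add: height_matrix_def row_def add_ac)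
      ultimately show ?thesis
        using laplace_expansion_column[OF carr, of j "\<mu>(j := \<mu> j + r)"] j by simp
    qed
    have "{..<n} = {..<N} \<union> {N..<n}" using assms by auto
    moreover have "(\<Sum>i<n. \<Sum>j<n. row H (H i + r) j * cof H i j)
      = (\<Sum>j<n. \<Sum>i<n. row H (H i + r) j * cof H i j)"
      by (rule sum.swap)
    ultimately have "(\<Sum>i<n. \<Sum>j<n. row H (H i + r) j * cof H i j)
      = (\<Sum>j<N. \<Sum>i<n. row H (H i + r) j * cof H i j)
        + (\<Sum>j\<in>{N..<n}. \<Sum>i<n. row H (H i + r) j * cof H i j)"
      by (simp add: sum.union_disjoint ivl_disj_int)
    then show ?thesis
      using 1 2 by (simp add: sum_distrib_right)
  qed
  have "(\<Sum>h<K. det (height_matrix N (Suc n) x \<mu> (H(n := h))))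
      + ((\<Sum>v<N. x v ^ r) * det (height_matrix N n x \<mu> H)
        + (\<Sum>j\<in>{N..<n}. det (height_matrix N n x (\<mu>(j := \<mu> j + r)) H))) \<in> pow_ideal N K x"
    if H: "H \<in> heights N K n" for H
  proof -
    \<comment> \<open>A dropped term has \<open>H i + r \<ge> K\<close>. Its entry is a high power
      of a variable if \<open>j < N\<close>, and \<open>0\<close> if \<open>j\<close> is a block,
      since the top of \<open>j\<close> lies below \<open>K\<close>.\<close>
    have row: "row H (H i + r) j * cof H i j
       - of_bool (H i + r < K) * (row H (H i + r) j * cof H i j) \<in> pow_ideal N K x"
      if "i < n" "j < n" for i j
    proof (cases "H i + r < K")
      case False
      have "H j < K" if "\<not> j < N"
        using H that \<open>j < n\<close> by (auto simp: heights_def PiE_iff split: if_splits)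
      then have "row H (H i + r) j \<in> pow_ideal N K x"
        using False by (auto simp: row_def intro: pow_ideal_power pow_ideal_0)
      then show ?thesis
        using False pow_ideal_mult[of _ N K x "cof H i j"] by (simp add: mult.commute[of "row _ _ _"])
    qed (simp add: pow_ideal_0)
    have "(\<Sum>i<n. \<Sum>j<n. row H (H i + r) j * cof H i j
       - of_bool (H i + r < K) * (row H (H i + r) j * cof H i j)) \<in> pow_ideal N K x"
      by (intro pow_ideal_sum row) auto
    then show ?thesis
      by (simp add: step full[symmetric] sum_subtractf)
  qed
  then have "(\<Sum>H\<in>heights N K n. (\<Sum>h<K. det (height_matrix N (Suc n) x \<mu> (H(n := h))))
      + ((\<Sum>v<N. x v ^ r) * det (height_matrix N n x \<mu> H)
        + (\<Sum>j\<in>{N..<n}. det (height_matrix N n x (\<mu>(j := \<mu> j + r)) H)))) \<in> pow_ideal N K x"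
    by (rule pow_ideal_sum)
  also have "(\<Sum>H\<in>heights N K n. (\<Sum>h<K. det (height_matrix N (Suc n) x \<mu> (H(n := h))))
      + ((\<Sum>v<N. x v ^ r) * det (height_matrix N n x \<mu> H)
        + (\<Sum>j\<in>{N..<n}. det (height_matrix N n x (\<mu>(j := \<mu> j + r)) H))))
    = height_sum N K (Suc n) x \<mu> + ((\<Sum>v<N. x v ^ r) * height_sum N K n x \<mu>
       + (\<Sum>i\<in>{N..<n}. height_sum N K n x (\<mu>(i := \<mu> i + r))))"
    unfolding height_sum_def sum_heights_Suc[OF assms(1)] sum.distrib sum_distrib_left[symmetric]
    by (simp only: sum.swap[of _ "heights N K n" "{N..<n}"])
  finally show ?thesis
    by (simp add: r_def)
qed

section \<open>Colourings constant on cycles\<close>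

text \<open>
  The sum runs over the colourings of \<open>X\<close> which are constant on the cycles of \<open>w\<close>, so for \<open>\<mu> = 1\<close> it
  is the power sum product of the cycle type. The weights \<open>\<mu>\<close> allow for merging points: removing
  \<open>a\<close> from its cycle adds \<open>\<mu> a\<close> to the weight of another point.
\<close>

definition cycle_weight ::
  "nat \<Rightarrow> (nat \<Rightarrow> 'r::comm_ring_1) \<Rightarrow> nat set \<Rightarrow> (nat \<Rightarrow> nat) \<Rightarrow> (nat \<Rightarrow> nat) \<Rightarrow> 'r" where
  "cycle_weight N x X \<mu> w =
     (\<Sum>c\<in>{c \<in> X \<rightarrow>\<^sub>E {..<N}. \<forall>i\<in>X. c (w i) = c i}. \<Prod>i\<in>X. x (c i) ^ \<mu> i)"

text \<open>The point \<open>a\<close> is a cycle of its own, so its colour is independent of the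
  others.\<close>

lemma cycle_weight_fixed_point:
  assumes "finite S" "a \<notin> S" "q permutes S"
  shows "cycle_weight N x (insert a S) \<mu> q = (\<Sum>v<N. x v ^ \<mu> a) * cycle_weight N x S \<mu> q"
proof -
  have q: "q a = a" "\<And>i. i \<in> S \<Longrightarrow> q i \<in> S"
    using assms by (auto simp: permutes_not_in permutes_in_image)
  let ?C = "{c \<in> S \<rightarrow>\<^sub>E {..<N}. \<forall>i\<in>S. c (q i) = c i}"
  have "(\<Sum>v<N. x v ^ \<mu> a) * cycle_weight N x S \<mu> q
    = (\<Sum>(v, c)\<in>{..<N} \<times> ?C. x v ^ \<mu> a * (\<Prod>i\<in>S. x (c i) ^ \<mu> i))"
    by (simp add: cycle_weight_def sum_product sum.cartesian_product)
  also have "\<dots> = cycle_weight N x (insert a S) \<mu> q"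
    unfolding cycle_weight_def
  proof (rule sum.reindex_bij_witness[where i = "\<lambda>c. (c a, restrict c S)" and j = "\<lambda>(v, c). c(a := v)"], goal_cases)
    case (1 b)
    then show ?case using assms(2) by (auto simp: fun_eq_iff PiE_iff extensional_def)
  next
    case (2 b)
    then show ?case using assms(2) q by (auto simp: PiE_iff extensional_def)
  next
    case (3 c)
    then show ?case using assms(2) by (auto simp: fun_eq_iff PiE_iff extensional_def)
  next
    case (4 c)
    then show ?case using assms(2) q by (auto simp: PiE_iff)
  next
    case (5 b)
    then show ?case using assms by (auto intro!: arg_cong2[of _ _ _ _ "(*)"] prod.cong)
  qed
  finally show ?thesis ..
qed

text \<open>Composing with the transposition inserts \<open>a\<close> just before \<open>b\<close>
  in the cycle of \<open>b\<close>. Hence \<open>a\<close> has the colour of \<open>b\<close>, and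
  the two weights add up.\<close>

lemma cycle_weight_transpose:
  assumes "finite S" "a \<notin> S" "b \<in> S" "q permutes S"
  shows "cycle_weight N x (insert a S) \<mu> (transpose a b \<circ> q)
    = cycle_weight N x S (\<mu>(b := \<mu> b + \<mu> a)) q"
proof -
  have q: "q a = a" "\<And>i. i \<in> S \<Longrightarrow> q i \<in> S"
    using assms by (auto simp: permutes_not_in permutes_in_image)
  have ab: "a \<noteq> b" using assms by auto
  have tr: "c (transpose a b j) = c j" if "c a = c b" for c :: "nat \<Rightarrow> nat" and j
    using that by (auto simp: transpose_def)
  have inS: "i \<noteq> a" if "i \<in> S" for i using that assms by auto
  have cab: "c b = c a" if "c \<in> {c \<in> insert a S \<rightarrow>\<^sub>E {..<N}. \<forall>i\<in>insert a S. c ((transpose a b \<circ> q) i) = c i}" for c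
    using that q by auto
  show ?thesis
    unfolding cycle_weight_def
  proof (rule sum.reindex_bij_witness[where j = "\<lambda>c. restrict c S" and i = "\<lambda>c. c(a := c b)"], goal_cases)
    case (1 c)
    note cab[OF 1]
    with 1 show ?case using assms by (auto simp: fun_eq_iff PiE_iff extensional_def)
  next
    case (2 c)
    note e = cab[OF 2]
    have "c (q i) = c i" if "i \<in> S" for i
      using 2 that tr[of c "q i"] e by auto
    with 2 show ?case using q by (auto simp: PiE_iff)
  next
    case (3 c)
    then show ?case using assms(2) by (auto simp: fun_eq_iff PiE_iff extensional_def)
  next
    case (4 c)
    have "(c(a := c b)) (transpose a b j) = (c(a := c b)) j" for j
      using ab by (intro tr) auto
    with 4 show ?case using q assms ab inS by (auto simp: PiE_iff extensional_def)
  next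
    case (5 c)
    have "(\<Prod>i\<in>S. x (restrict c S i) ^ (\<mu>(b := \<mu> b + \<mu> a)) i)
       = x (c b) ^ (\<mu> b + \<mu> a) * (\<Prod>i\<in>S - {b}. x (c i) ^ \<mu> i)"
      using assms by (subst prod.remove[of _ b]) auto
    also have "\<dots> = x (c a) ^ \<mu> a * (\<Prod>i\<in>S. x (c i) ^ \<mu> i)"
      using assms cab[OF 5] by (subst (2) prod.remove[of _ b]) (auto simp: power_add mult_ac)
    also have "\<dots> = (\<Prod>i\<in>insert a S. x (c i) ^ \<mu> i)"
      using assms by simp
    finally show ?case .
  qed
qed

section \<open>Sums over the permutations with prescribed values\<close>

text \<open>For \<open>X = {1..n}\<close> and unit weights this is the atomic symmetric function in
  \<open>N\<close> variables, see \<open>truncate_atomic\<close>. Other weights arise when points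
  are merged.\<close>

definition atomic_sum ::
  "nat \<Rightarrow> (nat \<Rightarrow> 'r::comm_ring_1) \<Rightarrow> nat set \<Rightarrow> nat list \<Rightarrow> nat list \<Rightarrow> (nat \<Rightarrow> nat) \<Rightarrow> 'r" where
  "atomic_sum N x X I J \<mu> = (\<Sum>w | w permutes X \<and> map w I = J. cycle_weight N x X \<mu> w)"

text \<open>Each permutation of \<open>insert a S\<close> is \<open>transpose a b \<circ> q\<close>
  for exactly one \<open>b\<close> and one permutation \<open>q\<close> of \<open>S\<close>. The
  case \<open>b = a\<close> gives the power sum, the others merge \<open>a\<close> into
  \<open>b\<close>.\<close>

lemma atomic_sum_insert:
  assumes "finite S" "a \<notin> S"
  shows "atomic_sum N x (insert a S) [] [] \<mu> =
    (\<Sum>v<N. x v ^ \<mu> a) * atomic_sum N x S [] [] \<mu>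
    + (\<Sum>b\<in>S. atomic_sum N x S [] [] (\<mu>(b := \<mu> b + \<mu> a)))"
  using assms
  by (simp add: atomic_sum_def sum_over_permutations_insert cycle_weight_fixed_point
      cycle_weight_transpose sum_distrib_left)

text \<open>
  Both sides satisfy the same recursion, by \<open>atomic_sum_insert\<close> and \<open>height_sum_Suc\<close>.
\<close>

lemma alternant_atomic_sum:
  assumes "bij_betw h {N..<N + m} X" "\<And>i. i \<in> X \<Longrightarrow> \<mu> i > 0"
  shows "alternant N x (\<lambda>i. i) * atomic_sum N x X [] [] \<mu>
    - (-1) ^ m * height_sum N K (N + m) x (\<mu> \<circ> h) \<in> pow_ideal N K x"
  using assms
proof (induction m arbitrary: X \<mu>)
  case 0
  then have "X = {}" by (auto simp: bij_betw_def)
  then show ?case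
    by (simp add: atomic_sum_def cycle_weight_def height_sum_base pow_ideal_0 )
next
  case (Suc m)
  define a where "a = h (N + m)"
  define S where "S = h ` {N..<N + m}"
  define P where "P = (\<Sum>v<N. x v ^ \<mu> a)"
  let ?V = "alternant N x (\<lambda>i. i)"
  let ?A = "atomic_sum N x S [] []"
  let ?Z = "height_sum N K (N + m) x"
  have inj: "inj_on h {N..<N + Suc m}" and "X = h ` {N..<N + Suc m}"
    using Suc.prems by (auto simp: bij_betw_def)
  moreover have "{N..<N + Suc m} = insert (N + m) {N..<N + m}" by auto
  ultimately have X: "X = insert a S" "a \<notin> S" and inj': "inj_on h {N..<N + m}"
    unfolding a_def S_def by (auto simp: inj_on_def)
  have S: "bij_betw h {N..<N + m} S" "finite S"
    using inj' by (auto simp: S_def bij_betw_def)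
  have 1: "?V * ?A \<mu> - (-1) ^ m * ?Z (\<mu> \<circ> h) \<in> pow_ideal N K x"
    using Suc.prems X by (intro Suc.IH[OF S(1)]) auto
  have 2: "?V * ?A (\<mu>(h i := \<mu> (h i) + \<mu> a)) - (-1) ^ m * ?Z ((\<mu> \<circ> h)(i := (\<mu> \<circ> h) i + \<mu> a)) \<in> pow_ideal N K x"
    if "i \<in> {N..<N + m}" for i
  proof -
    have "?V * ?A (\<mu>(h i := \<mu> (h i) + \<mu> a)) - (-1) ^ m * ?Z (\<mu>(h i := \<mu> (h i) + \<mu> a) \<circ> h) \<in> pow_ideal N K x"
      using Suc.prems X by (intro Suc.IH[OF S(1)]) auto
    \<comment> \<open>The two weight functions need agree only on the blocks, where \<open>h\<close>
      is injective; \<open>height_matrix\<close> reads no other weights.\<close>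
    moreover have "?Z (\<mu>(h i := \<mu> (h i) + \<mu> a) \<circ> h) = ?Z ((\<mu> \<circ> h)(i := (\<mu> \<circ> h) i + \<mu> a))"
      unfolding height_sum_def height_matrix_def
      by (intro sum.cong refl arg_cong[of _ _ det] eq_matI) (use that inj' in \<open>auto dest: inj_onD\<close>)
    ultimately show ?thesis by simp
  qed
  have 3: "height_sum N K (N + Suc m) x (\<mu> \<circ> h) + (P * ?Z (\<mu> \<circ> h)
       + (\<Sum>i\<in>{N..<N + m}. ?Z ((\<mu> \<circ> h)(i := (\<mu> \<circ> h) i + \<mu> a)))) \<in> pow_ideal N K x"
    using height_sum_Suc[of N "N + m" "\<mu> \<circ> h" K x] Suc.prems X by (simp add: P_def a_def)
  have "atomic_sum N x X [] [] \<mu> = P * ?A \<mu> + (\<Sum>b\<in>S. ?A (\<mu>(b := \<mu> b + \<mu> a)))"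
    unfolding X(1) P_def by (rule atomic_sum_insert[OF S(2) X(2)])
  also have "(\<Sum>b\<in>S. ?A (\<mu>(b := \<mu> b + \<mu> a))) = (\<Sum>i\<in>{N..<N + m}. ?A (\<mu>(h i := \<mu> (h i) + \<mu> a)))"
    unfolding S_def by (rule sum.reindex[OF inj', unfolded o_def])
  \<comment> \<open>In \<open>3\<close> it is the sum of \<open>height_sum\<close> and its recursive
    terms that lies in the ideal, so each further block flips the sign.\<close>
  finally have "?V * atomic_sum N x X [] [] \<mu> - (-1) ^ Suc m * height_sum N K (N + Suc m) x (\<mu> \<circ> h)
    = P * (?V * ?A \<mu> - (-1) ^ m * ?Z (\<mu> \<circ> h))
      + (\<Sum>i\<in>{N..<N + m}. ?V * ?A (\<mu>(h i := \<mu> (h i) + \<mu> a)) - (-1) ^ m * ?Z ((\<mu> \<circ> h)(i := (\<mu> \<circ> h) i + \<mu> a)))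
      + (-1) ^ m * (height_sum N K (N + Suc m) x (\<mu> \<circ> h) + (P * ?Z (\<mu> \<circ> h)
       + (\<Sum>i\<in>{N..<N + m}. ?Z ((\<mu> \<circ> h)(i := (\<mu> \<circ> h) i + \<mu> a)))))"
    by (simp add: algebra_simps sum_subtractf sum_distrib_left)
  also have "\<dots> \<in> pow_ideal N K x"
    by (intro pow_ideal_add pow_ideal_mult[OF 1] pow_ideal_mult[OF 3] pow_ideal_sum 2)
  finally show ?case .
qed

text \<open>The arrows are contracted one at a time: a loop at \<open>i\<close> splits off a power
  sum, any other arrow from \<open>i\<close> to \<open>j\<close> adds the weight of \<open>i\<close>
  to that of \<open>j\<close>. The \<open>m\<close> points left at the end are free. For them
  \<open>N + m\<close> tops compete for \<open>N + m - 1\<close> heights, and \<open>m > 0\<close>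
  puts all bases below the bound.\<close>

lemma atomic_sum_in_pow_ideal:
  assumes "finite X" "\<And>i. i \<in> X \<Longrightarrow> \<mu> i > 0"
    and "distinct I" "distinct J" "set I \<subseteq> X" "set J \<subseteq> X" "length I = length J"
    and "card X = length I + m" "m > 0"
  shows "alternant N x (\<lambda>i. i) * atomic_sum N x X I J \<mu> \<in> pow_ideal N (N + m - 1) x"
  using assms
proof (induction I arbitrary: X J \<mu>)
  case Nil
  obtain h where "bij_betw h {0..<m} X"
    using Nil.prems ex_bij_betw_nat_finite by force
  moreover have "bij_betw (\<lambda>i. i - N) {N..<N + m} {0..<m}"
    by (rule bij_betw_byWitness[where f' = "\<lambda>i. i + N"]) auto
  ultimately have "bij_betw (h \<circ> (\<lambda>i. i - N)) {N..<N + m} X"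
    using bij_betw_trans by blast
  from alternant_atomic_sum[OF this, of \<mu> x "N + m - 1"] Nil.prems
  show ?case
    by (simp add: height_sum_pigeonhole)
next
  case (Cons i I)
  obtain j J' where J: "J = j # J'"
    using Cons.prems by (cases J) auto
  define S where "S = X - {i}"
  have S: "finite S" "i \<notin> S" "X = insert i S" "j \<in> insert i S"
    using Cons.prems J by (auto simp: S_def)
  \<comment> \<open>Contracting the arrow from \<open>i\<close> to \<open>j\<close> redirects an
    arrow that ends in \<open>i\<close> to \<open>j\<close>.\<close>
  define J'' where "J'' = map (transpose i j) J'"
  \<comment> \<open>As \<open>q\<close> fixes \<open>i\<close>, the composition sends
    \<open>i\<close> to \<open>b\<close>; the first constraint therefore only selects
    \<open>b = j\<close>.\<close>
  have iff: "map (transpose i b \<circ> q) (i # I) = J \<longleftrightarrow> b = j \<and> map q I = J''" if "q permutes S" for b q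
  proof -
    have "q i = i" using that S by (simp add: permutes_not_in)
    moreover have "map (transpose i j \<circ> q) I = J' \<longleftrightarrow> map q I = J''"
    proof -
      have "map (transpose i j) (map (transpose i j) xs) = xs" for xs
        by (induction xs) simp_all
      then show ?thesis
        unfolding J''_def map_map[symmetric] by metis
    qed
    ultimately show ?thesis
      by (auto simp: J)
  qed
  have fin: "finite {q. q permutes S}" by (rule finite_permutations[OF S(1)])
  have "atomic_sum N x X (i # I) J \<mu> =
    (\<Sum>w | w permutes insert i S. if map w (i # I) = J then cycle_weight N x X \<mu> w else 0)"
    unfolding atomic_sum_def S(3)
    by (subst sum.inter_filter[symmetric])
      (simp_all only: mem_Collect_eq finite_permutations finite_insert S(1))
  also have "\<dots> = (\<Sum>b\<in>insert i S. \<Sum>q | q permutes S.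
     if map (transpose i b \<circ> q) (i # I) = J then cycle_weight N x X \<mu> (transpose i b \<circ> q) else 0)"
    by (rule sum_over_permutations_insert[OF S(1,2)])
  also have "\<dots> = (\<Sum>b\<in>insert i S. if b = j then
      (\<Sum>q | q permutes S \<and> map q I = J''. cycle_weight N x X \<mu> (transpose i b \<circ> q)) else 0)"
  proof (intro sum.cong refl)
    fix b
    have "(\<Sum>q | q permutes S.
       if map (transpose i b \<circ> q) (i # I) = J then cycle_weight N x X \<mu> (transpose i b \<circ> q) else 0)
      = (\<Sum>q | q permutes S.
       if b = j \<and> map q I = J'' then cycle_weight N x X \<mu> (transpose i b \<circ> q) else 0)"
      using iff by (intro sum.cong refl if_cong) auto
    also have "\<dots> = (if b = j then
      (\<Sum>q | q permutes S \<and> map q I = J''. cycle_weight N x X \<mu> (transpose i b \<circ> q)) else 0)"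
      using sum.inter_filter[OF fin, of "\<lambda>q. cycle_weight N x X \<mu> (transpose i b \<circ> q)"
          "\<lambda>q. map q I = J''"] by auto
    finally show "(\<Sum>q | q permutes S.
       if map (transpose i b \<circ> q) (i # I) = J then cycle_weight N x X \<mu> (transpose i b \<circ> q) else 0)
      = (if b = j then
      (\<Sum>q | q permutes S \<and> map q I = J''. cycle_weight N x X \<mu> (transpose i b \<circ> q)) else 0)" .
  qed
  also have "\<dots> = (\<Sum>q | q permutes S \<and> map q I = J''. cycle_weight N x X \<mu> (transpose i j \<circ> q))"
    using S by simp
  also have "\<dots> = (if i = j then (\<Sum>v<N. x v ^ \<mu> i) * atomic_sum N x S I J'' \<mu>
     else atomic_sum N x S I J'' (\<mu>(j := \<mu> j + \<mu> i)))"
    using S unfolding atomic_sum_def S(3)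
    by (auto simp: cycle_weight_fixed_point cycle_weight_transpose sum_distrib_left intro!: sum.cong)
  finally have eq: "atomic_sum N x X (i # I) J \<mu> = \<dots>" .
  have "set J'' \<subseteq> S"
    using Cons.prems J by (auto simp: J''_def S_def transpose_def)
  moreover have "distinct J''"
    using Cons.prems J by (simp add: J''_def distinct_map)
  ultimately have IH: "alternant N x (\<lambda>i. i) * atomic_sum N x S I J'' \<mu>' \<in> pow_ideal N (N + m - 1) x"
    if "\<And>i. i \<in> S \<Longrightarrow> \<mu>' i > 0" for \<mu>'
    using Cons.prems J S by (intro Cons.IH that) (auto simp: J''_def)
  have pos: "\<And>l. l \<in> S \<Longrightarrow> \<mu> l > 0"
    using Cons.prems(2) S(3) by blast
  show ?case
  proof (cases "i = j")
    case True
    have "(\<Sum>v<N. x v ^ \<mu> i) * (alternant N x (\<lambda>i. i) * atomic_sum N x S I J'' \<mu>)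
        \<in> pow_ideal N (N + m - 1) x"
      by (intro pow_ideal_mult IH pos)
    then show ?thesis
      unfolding eq if_P[OF True] by (simp add: mult_ac)
  next
    case False
    show ?thesis
      unfolding eq if_not_P[OF False] by (rule IH) (use pos in auto)
  qed
qed

section \<open>The bialternant formula\<close>

text \<open>Row lengths form a function that is meant to be \<open>0\<close> from some row on. The
  induction on the number of variables then needs no lists of varying length.\<close>

definition shape :: "(nat \<Rightarrow> nat) \<Rightarrow> (nat \<times> nat) set" where
  "shape f = {(i, j). j < f i}"

definition ssyt :: "nat \<Rightarrow> (nat \<Rightarrow> nat) \<Rightarrow> (nat \<times> nat \<Rightarrow> nat) set" where
  "ssyt N f = {T \<in> shape f \<rightarrow>\<^sub>E {..<N}.
     (\<forall>i j j'. j < j' \<and> j' < f i \<longrightarrow> T (i, j) \<le> T (i, j')) \<and>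
     (\<forall>i i' j. i < i' \<and> j < f i \<and> j < f i' \<longrightarrow> T (i, j) < T (i', j))}"

definition schur_poly :: "nat \<Rightarrow> (nat \<Rightarrow> 'r::comm_ring_1) \<Rightarrow> (nat \<Rightarrow> nat) \<Rightarrow> 'r" where
  "schur_poly N x f = (\<Sum>T\<in>ssyt N f. \<Prod>c\<in>shape f. x (T c))"

lemma alternant_cong:
  assumes "\<And>i. i < N \<Longrightarrow> \<gamma> i = \<gamma>' i"
  shows "alternant N x \<gamma> = alternant N x \<gamma>'"
  unfolding alternant_def by (intro arg_cong[of _ _ det] eq_matI) (simp_all add: assms)

section \<open>Branching of alternants\<close>

text \<open>This is \<open>x ^ c\<close> times the geometric sum for
  \<open>x ^ (b - c) - y ^ (b - c)\<close>. In this form the exponents of \<open>x\<close> run over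
  the interval that becomes an interlacing condition in \<open>alternant_Suc\<close>.\<close>

lemma power_diff_interval:
  fixes x y :: "'r::comm_ring_1"
  assumes "c \<le> b"
  shows "x ^ b - x ^ c * y ^ (b - c) = (x - y) * (\<Sum>t\<in>{c..<b}. x ^ t * y ^ (b - 1 - t))"
  using assms
proof (induction b rule: dec_induct)
  case (step b)
  have "(\<Sum>t\<in>{c..<Suc b}. x ^ t * y ^ (Suc b - 1 - t))
    = x ^ b + (\<Sum>t\<in>{c..<b}. y * (x ^ t * y ^ (b - 1 - t)))"
  proof -
    have "y ^ (b - t) = y * y ^ (b - 1 - t)" if "t < b" for t
      using that by (simp flip: power_Suc add: Suc_diff_Suc)
    then have "(\<Sum>t\<in>{c..<b}. x ^ t * y ^ (b - t)) = (\<Sum>t\<in>{c..<b}. y * (x ^ t * y ^ (b - 1 - t)))"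
      by (intro sum.cong) simp_all
    with step.hyps show ?thesis
      by simp
  qed
  then have "(x - y) * (\<Sum>t\<in>{c..<Suc b}. x ^ t * y ^ (Suc b - 1 - t))
    = (x - y) * x ^ b + y * (x ^ b - x ^ c * y ^ (b - c))"
    by (simp only: distrib_left step.IH sum_distrib_left[symmetric] mult.left_commute)
  then show ?case
    using step.hyps by (simp add: algebra_simps Suc_diff_le)
qed simp

lemma det_scale_columns:
  fixes d :: "nat \<Rightarrow> 'r::comm_ring_1"
  shows "det (mat N N (\<lambda>(i, j). d j * a i j)) = (\<Prod>j<N. d j) * det (mat N N (\<lambda>(i, j). a i j))"
proof -
  have "(\<Prod>i = 0..<N. mat N N (\<lambda>(i, j). d j * a i j) $$ (i, p i))
    = (\<Prod>j<N. d j) * (\<Prod>i = 0..<N. mat N N (\<lambda>(i, j). a i j) $$ (i, p i))"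
    if p: "p permutes {0..<N}" for p
  proof -
    have "(\<Prod>j<N. d j) = (\<Prod>i = 0..<N. d (p i))"
      using prod.permute[OF p, of d] by (simp add: lessThan_atLeast0)
    moreover have "p i < N" if "i < N" for i
      using permutes_in_image[OF p, of i] that by simp
    ultimately show ?thesis
      by (simp add: prod.distrib)
  qed
  then show ?thesis
    by (simp add: det_def'[where n = N] sum_distrib_left mult_ac)
qed

text \<open>By multilinearity in the rows, \<open>\<beta>\<close> chooses one summand from each
  row.\<close>

lemma det_sum_rows:
  fixes x :: "nat \<Rightarrow> 'r::comm_ring_1"
  assumes "\<And>i. i < N \<Longrightarrow> finite (B i)"
  shows "det (mat N N (\<lambda>(i, j). \<Sum>b\<in>B i. x j ^ b * w i b))
    = (\<Sum>\<beta>\<in>Pi\<^sub>E {..<N} B. (\<Prod>i<N. w i (\<beta> i)) * alternant N x \<beta>)"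
proof -
  have "(\<Prod>i = 0..<N. mat N N (\<lambda>(i, j). \<Sum>b\<in>B i. x j ^ b * w i b) $$ (i, p i))
    = (\<Sum>\<beta>\<in>Pi\<^sub>E {..<N} B. (\<Prod>i<N. w i (\<beta> i)) * (\<Prod>i = 0..<N. mat N N (\<lambda>(i, j). x j ^ \<beta> i) $$ (i, p i)))"
    if p: "p permutes {0..<N}" for p
  proof -
    have pN: "p i < N" if "i < N" for i
      using permutes_in_image[OF p, of i] that by simp
    have "(\<Prod>i = 0..<N. mat N N (\<lambda>(i, j). \<Sum>b\<in>B i. x j ^ b * w i b) $$ (i, p i))
      = (\<Prod>i<N. \<Sum>b\<in>B i. x (p i) ^ b * w i b)"
      using pN by (simp add: lessThan_atLeast0)
    also have "\<dots> = (\<Sum>\<beta>\<in>Pi\<^sub>E {..<N} B. \<Prod>i<N. x (p i) ^ \<beta> i * w i (\<beta> i))"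
      using assms by (intro prod_sum_PiE) auto
    finally show ?thesis
      using pN by (simp add: prod.distrib mult.commute lessThan_atLeast0)
  qed
  then have "det (mat N N (\<lambda>(i, j). \<Sum>b\<in>B i. x j ^ b * w i b)) =
    (\<Sum>p | p permutes {0..<N}. \<Sum>\<beta>\<in>Pi\<^sub>E {..<N} B.
       (\<Prod>i<N. w i (\<beta> i)) * (signof p * (\<Prod>i = 0..<N. mat N N (\<lambda>(i, j). x j ^ \<beta> i) $$ (i, p i))))"
    by (simp add: det_def'[where n = N] sum_distrib_left mult.left_commute del: index_mat)
  also have "\<dots> = (\<Sum>\<beta>\<in>Pi\<^sub>E {..<N} B. \<Sum>p | p permutes {0..<N}.
       (\<Prod>i<N. w i (\<beta> i)) * (signof p * (\<Prod>i = 0..<N. mat N N (\<lambda>(i, j). x j ^ \<beta> i) $$ (i, p i))))"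
    by (rule sum.swap)
  also have "\<dots> = (\<Sum>\<beta>\<in>Pi\<^sub>E {..<N} B. (\<Prod>i<N. w i (\<beta> i)) * alternant N x \<beta>)"
    by (simp add: alternant_def det_def'[where n = N] sum_distrib_left del: index_mat)
  finally show ?thesis .
qed

text \<open>Once the last column is cleared, column \<open>j\<close> of the remaining minor is
  divisible by \<open>x j - x N\<close>. The quotients are geometric sums, and expanding them row by
  row leaves alternants whose exponents interlace with \<open>\<gamma>\<close>.\<close>

lemma alternant_Suc:
  fixes x :: "nat \<Rightarrow> 'r::comm_ring_1"
  assumes dec: "\<And>i. i < N \<Longrightarrow> \<gamma> (Suc i) \<le> \<gamma> i"
  shows "alternant (Suc N) x \<gamma> = x N ^ \<gamma> N * (\<Prod>j<N. x j - x N) *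
    (\<Sum>\<beta>\<in>(\<Pi>\<^sub>E i\<in>{..<N}. {\<gamma> (Suc i)..<\<gamma> i}). (\<Prod>i<N. x N ^ (\<gamma> i - 1 - \<beta> i)) * alternant N x \<beta>)"
proof -
  define A where "A = mat (Suc N) (Suc N) (\<lambda>(i, j). x j ^ \<gamma> i)"
  define L where "L = mat (Suc N) (Suc N) (\<lambda>(i, j). if j = i then 1
    else if j = Suc i then - (x N ^ (\<gamma> i - \<gamma> (Suc i))) else 0)"
  define B where "B = mat (Suc N) (Suc N) (\<lambda>(i, j). if i < N
    then x j ^ \<gamma> i - x j ^ \<gamma> (Suc i) * x N ^ (\<gamma> i - \<gamma> (Suc i)) else x j ^ \<gamma> i)"
  have carr: "A \<in> carrier_mat (Suc N) (Suc N)" "L \<in> carrier_mat (Suc N) (Suc N)" "B \<in> carrier_mat (Suc N) (Suc N)"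
    by (simp_all add: A_def L_def B_def)
  \<comment> \<open>Subtracting from each row a multiple of the next one clears the last column above its bottom entry.\<close>
  have "det L = prod_list (diag_mat L)"
    by (rule det_upper_triangular[OF _ carr(2)]) (auto simp: L_def)
  also have "\<dots> = 1"
    by (simp add: prod_list_diag_prod L_def)
  finally have "det L = 1" .
  have "L * A = B"
  proof (rule eq_matI)
    fix i j assume "i < dim_row B" "j < dim_col B"
    then have ij: "i < Suc N" "j < Suc N" by (simp_all add: B_def)
    have "(L * A) $$ (i, j) = (\<Sum>k<Suc N. L $$ (i, k) * A $$ (k, j))"
      using ij carr by (simp add: scalar_prod_def lessThan_atLeast0 row_def col_def)
    also have "\<dots> = (\<Sum>k<Suc N. (if k = i then x j ^ \<gamma> i else 0)
      + (if k = Suc i then - (x N ^ (\<gamma> i - \<gamma> (Suc i))) * x j ^ \<gamma> (Suc i) else 0))"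
      using ij by (intro sum.cong) (auto simp: L_def A_def)
    also have "\<dots> = B $$ (i, j)"
      using ij by (simp only: sum.distrib sum.delta finite_lessThan) (auto simp: B_def mult.commute)
    finally show "(L * A) $$ (i, j) = B $$ (i, j)" .
  qed (use carr in auto)
  then have "det A = det B"
    using det_mult[OF carr(2,1)] \<open>det L = 1\<close> by simp
  also have "det B = (\<Sum>i<Suc N. B $$ (i, N) * cofactor B i N)"
    by (rule laplace_expansion_column[OF carr(3)]) simp
  also have "\<dots> = x N ^ \<gamma> N * cofactor B N N"
  proof -
    have "B $$ (i, N) = 0" if "i < N" for i
      using that dec[OF that] by (simp add: B_def flip: power_add)
    then show ?thesis by (simp add: B_def)
  qed
  also have "cofactor B N N = det (mat_delete B N N)"
    by (simp add: cofactor_def flip: mult_2)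
  also have "mat_delete B N N = mat N N (\<lambda>(i, j). (x j - x N) *
      (\<Sum>b\<in>{\<gamma> (Suc i)..<\<gamma> i}. x j ^ b * x N ^ (\<gamma> i - 1 - b)))"
    by (intro eq_matI) (simp_all add: mat_delete_def B_def power_diff_interval[OF dec])
  finally show ?thesis
    by (simp add: alternant_def[of "Suc N"] A_def[symmetric] det_scale_columns det_sum_rows mult.assoc)
qed

section \<open>Branching of semistandard tableaux\<close>

lemma finite_shape:
  assumes "\<And>i. i \<ge> N \<Longrightarrow> f i = 0"
  shows "finite (shape f)"
proof (rule finite_subset)
  show "shape f \<subseteq> (SIGMA i:{..<N}. {..<f i})"
  proof
    fix c assume c: "c \<in> shape f"
    then have "fst c < N"
      using assms[of "fst c"] by (cases "fst c < N") (auto simp: shape_def)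
    with c show "c \<in> (SIGMA i:{..<N}. {..<f i})" by (auto simp: shape_def)
  qed
qed simp

lemma finite_ssyt:
  assumes "\<And>i. i \<ge> N \<Longrightarrow> f i = 0"
  shows "finite (ssyt M f)"
proof (rule finite_subset)
  show "ssyt M f \<subseteq> shape f \<rightarrow>\<^sub>E {..<M}" by (auto simp: ssyt_def)
  show "finite (shape f \<rightarrow>\<^sub>E {..<M})" by (intro finite_PiE finite_shape assms) simp_all
qed


lemma initial_segment_card:
  fixes g :: nat
  assumes "\<And>j j'. j < j' \<Longrightarrow> j' < g \<Longrightarrow> P j' \<Longrightarrow> P j"
  shows "{j. j < g \<and> P j} = {..<card {j. j < g \<and> P j}}"
  using assms
proof (induction g)
  case (Suc g)
  show ?case
  proof (cases "P g")
    case True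
    then have "{j. j < Suc g \<and> P j} = {..<Suc g}"
      using Suc.prems by (auto simp: less_Suc_eq)
    then show ?thesis by simp
  next
    case False
    then have "{j. j < Suc g \<and> P j} = {j. j < g \<and> P j}"
      by (auto simp: less_Suc_eq)
    moreover have "{j. j < g \<and> P j} = {..<card {j. j < g \<and> P j}}"
      by (rule Suc.IH) (use Suc.prems in \<open>auto intro: less_SucI\<close>)
    ultimately show ?thesis by simp
  qed
qed simp

text \<open>
  The row lengths of the subtableau formed by the entries other than the largest letter \<open>N\<close>.
\<close>

definition small_length :: "nat \<Rightarrow> (nat \<Rightarrow> nat) \<Rightarrow> (nat \<times> nat \<Rightarrow> nat) \<Rightarrow> nat \<Rightarrow> nat" where
  "small_length N f T i = card {j. j < f i \<and> T (i, j) < N}"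

lemma ssytD:
  assumes "T \<in> ssyt N f"
  shows "j < f i \<Longrightarrow> T (i, j) < N"
    and "c \<notin> shape f \<Longrightarrow> T c = undefined"
    and "j < j' \<Longrightarrow> j' < f i \<Longrightarrow> T (i, j) \<le> T (i, j')"
    and "i < i' \<Longrightarrow> j < f i \<Longrightarrow> j < f i' \<Longrightarrow> T (i, j) < T (i', j)"
  using assms by (auto simp: ssyt_def shape_def PiE_def Pi_def extensional_def)

lemma ssytI:
  assumes "\<And>i j. j < f i \<Longrightarrow> T (i, j) < N"
    and "\<And>c. c \<notin> shape f \<Longrightarrow> T c = undefined"
    and "\<And>i j j'. j < j' \<Longrightarrow> j' < f i \<Longrightarrow> T (i, j) \<le> T (i, j')"
    and "\<And>i i' j. i < i' \<Longrightarrow> j < f i \<Longrightarrow> j < f i' \<Longrightarrow> T (i, j) < T (i', j)"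
  shows "T \<in> ssyt N f"
  using assms by (auto simp: ssyt_def shape_def PiE_def Pi_def extensional_def)

text \<open>Rows increase weakly, so the small entries of a row form an initial segment, whose
  length is their number.\<close>

lemma small_length_iff:
  assumes "T \<in> ssyt M f"
  shows "j < small_length N f T i \<longleftrightarrow> j < f i \<and> T (i, j) < N"
proof -
  have "{j. j < f i \<and> T (i, j) < N} = {..<small_length N f T i}"
    unfolding small_length_def
    by (rule initial_segment_card) (use ssytD(3)[OF assms] in \<open>blast intro: le_less_trans\<close>)
  then show ?thesis by blast
qed

text \<open>The column above a cell is complete because \<open>f\<close> is antimonotone, and its
  entries increase strictly.\<close>

lemma ssyt_row_le:
  assumes "antimono f" "T \<in> ssyt M f" "j < f i"
  shows "i \<le> T (i, j)"
  using assms(3)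
proof (induction i)
  case (Suc i)
  have "f (Suc i) \<le> f i" using assms(1) by (simp add: antimonoD)
  with Suc have "j < f i" by simp
  with Suc ssytD(4)[OF assms(2), of i "Suc i" j] show ?case by simp
qed simp

text \<open>The cells with letter \<open>N\<close> form a horizontal strip: two of them in one
  column would violate strictness. This gives the interlacing. From row \<open>N\<close> on, no
  entry is small, by \<open>ssyt_row_le\<close>.\<close>

lemma small_length_bounds:
  assumes "antimono f" "T \<in> ssyt (Suc N) f"
  shows "small_length N f T i \<le> f i" "f (Suc i) \<le> small_length N f T i"
    and "i \<ge> N \<Longrightarrow> small_length N f T i = 0"
proof -
  note iff = small_length_iff[OF assms(2), of _ N]
  show "small_length N f T i \<le> f i"
    using iff[of "f i" i] by (simp add: not_less)
  show "f (Suc i) \<le> small_length N f T i"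
  proof (rule ccontr)
    let ?j = "small_length N f T i"
    assume "\<not> ?thesis"
    then have j: "?j < f (Suc i)" by simp
    moreover have "f (Suc i) \<le> f i" using assms(1) by (simp add: antimonoD)
    ultimately have "T (i, ?j) < T (Suc i, ?j)" "T (Suc i, ?j) < Suc N" "?j < f i"
      using ssytD(4)[OF assms(2), of i "Suc i"] ssytD(1)[OF assms(2)] by auto
    then have "?j < f i \<and> T (i, ?j) < N" by linarith
    then have "?j < ?j" using iff[of ?j i] by blast
    then show False by simp
  qed
  show "small_length N f T i = 0" if "i \<ge> N"
    using iff[of 0 i] ssyt_row_le[OF assms, of 0 i] that by fastforce
qed

text \<open>A tableau is determined by its subtableau of entries below \<open>N\<close>, since the
  remaining horizontal strip is filled with \<open>N\<close>. Conversely, interlacing is all that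
  such a filling requires.\<close>

lemma schur_poly_Suc:
  fixes x :: "nat \<Rightarrow> 'r::comm_ring_1"
  assumes f: "antimono f" "f (Suc N) = 0"
  shows "schur_poly (Suc N) x f = (\<Sum>\<nu>\<in>(\<Pi>\<^sub>E i\<in>{..<N}. {f (Suc i)..f i}).
     x N ^ (f N + (\<Sum>i<N. f i - \<nu> i)) * schur_poly N x (\<lambda>i. if i < N then \<nu> i else 0))"
proof -
  have f0: "f i = 0" if "i \<ge> Suc N" for i
    using antimonoD[OF f(1) that] f(2) by simp
  \<comment> \<open>Elements of \<open>P\<close> are \<open>undefined\<close> from \<open>N\<close>
    on; \<open>ext\<close> turns them into row lengths.\<close>
  define ext where "ext \<nu> = (\<lambda>i. if i < N then \<nu> i else 0)" for \<nu> :: "nat \<Rightarrow> nat"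
  define P where "P = (\<Pi>\<^sub>E i\<in>{..<N}. {f (Suc i)..f i})"
  define glue where "glue \<nu> T = (\<lambda>c. if c \<in> shape (ext \<nu>) then T c
    else if c \<in> shape f then N else undefined)" for \<nu> and T :: "nat \<times> nat \<Rightarrow> nat"
  define cut where "cut T = (\<lambda>i\<in>{..<N}. small_length N f T i)" for T
  have finP: "finite P" unfolding P_def by (intro finite_PiE) auto
  have finext: "finite (ssyt N (ext \<nu>))" for \<nu>
    by (rule finite_ssyt[of N]) (simp add: ext_def)
  have ext_le: "ext \<nu> i \<le> f i" and ext_ge: "f (Suc i) \<le> ext \<nu> i" if "\<nu> \<in> P" for \<nu> i
    using that f0[of "Suc i"] by (auto simp: P_def PiE_iff ext_def)
  have ext_cut: "ext (cut T) = small_length N f T" if "T \<in> ssyt (Suc N) f" for T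
    using small_length_bounds(3)[OF f(1) that] by (auto simp: ext_def cut_def)
  have cutP: "cut T \<in> P" if "T \<in> ssyt (Suc N) f" for T
    using small_length_bounds[OF f(1) that] by (auto simp: P_def cut_def)
  have restr: "restrict T (shape (ext (cut T))) \<in> ssyt N (ext (cut T))" if T: "T \<in> ssyt (Suc N) f" for T
  proof -
    have small: "j < ext (cut T) i \<longleftrightarrow> j < f i \<and> T (i, j) < N" for i j
      by (simp add: ext_cut[OF T] small_length_iff[OF T])
    have eq: "restrict T (shape (ext (cut T))) (i, j) = T (i, j)" if "j < ext (cut T) i" for i j
      using that by (simp add: shape_def)
    show ?thesis
    proof (rule ssytI)
      fix i j j' assume j: "j < j'" "j' < ext (cut T) i"
      moreover from j have "j < ext (cut T) i" by simp
      ultimately show "restrict T (shape (ext (cut T))) (i, j) \<le> restrict T (shape (ext (cut T))) (i, j')"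
        using eq ssytD(3)[OF T] small by simp
    next
      fix i i' j assume "i < i'" "j < ext (cut T) i" "j < ext (cut T) i'"
      then show "restrict T (shape (ext (cut T))) (i, j) < restrict T (shape (ext (cut T))) (i', j)"
        using eq ssytD(4)[OF T] small by simp
    qed (use eq small in auto)
  qed
  have glue: "glue \<nu> T \<in> ssyt (Suc N) f" if \<nu>: "\<nu> \<in> P" and T: "T \<in> ssyt N (ext \<nu>)" for \<nu> T
  proof (rule ssytI)
    note D = ssytD[OF T]
    show "glue \<nu> T (i, j) < Suc N" if "j < f i" for i j
      using that D(1) by (auto simp: glue_def shape_def less_Suc_eq)
    show "glue \<nu> T c = undefined" if "c \<notin> shape f" for c
      using that ext_le[OF \<nu>, of "fst c"] by (auto simp: glue_def shape_def)
    show "glue \<nu> T (i, j) \<le> glue \<nu> T (i, j')" if "j < j'" "j' < f i" for i j j'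
      using that D(1,3) by (auto simp: glue_def shape_def less_imp_le)
    show "glue \<nu> T (i, j) < glue \<nu> T (i', j)" if ij: "i < i'" "j < f i" "j < f i'" for i i' j
    proof -
      \<comment> \<open>By interlacing, the upper of two cells in a column always lies in the small
        shape.\<close>
      have "f i' \<le> f (Suc i)" using ij antimonoD[OF f(1), of "Suc i" i'] by simp
      with ij ext_ge[OF \<nu>, of i] have "j < ext \<nu> i" by simp
      with ij D(1,4) show ?thesis by (auto simp: glue_def shape_def)
    qed
  qed
  have glue_small: "small_length N f (glue \<nu> T) i = ext \<nu> i" if \<nu>: "\<nu> \<in> P" and T: "T \<in> ssyt N (ext \<nu>)" for \<nu> T i
  proof -
    have "{j. j < f i \<and> glue \<nu> T (i, j) < N} = {..<ext \<nu> i}"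
      using ext_le[OF \<nu>, of i] ssytD(1)[OF T] by (auto simp: glue_def shape_def split: if_splits)
    then show ?thesis by (simp add: small_length_def)
  qed
  have weight: "(\<Prod>c\<in>shape f. x (glue \<nu> T c))
      = x N ^ (f N + (\<Sum>i<N. f i - \<nu> i)) * (\<Prod>c\<in>shape (ext \<nu>). x (T c))"
    if \<nu>: "\<nu> \<in> P" for \<nu> T
  proof -
    have sub: "shape (ext \<nu>) \<subseteq> shape f"
      using ext_le[OF \<nu>] by (auto simp: shape_def intro: less_le_trans)
    have "shape f - shape (ext \<nu>) = (SIGMA i:{..<Suc N}. {ext \<nu> i..<f i})"
    proof (intro equalityI subsetI)
      fix c assume c: "c \<in> shape f - shape (ext \<nu>)"
      then have "fst c < Suc N"
        using f0[of "fst c"] by (cases "fst c < Suc N") (auto simp: shape_def)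
      with c show "c \<in> (SIGMA i:{..<Suc N}. {ext \<nu> i..<f i})"
        by (auto simp: shape_def)
    qed (auto simp: shape_def)
    \<comment> \<open>Row \<open>N\<close> consists of letters \<open>N\<close> only and contributes
      the summand \<open>f N\<close>.\<close>
    then have "card (shape f - shape (ext \<nu>)) = f N + (\<Sum>i<N. f i - \<nu> i)"
      by (simp add: ext_def)
    moreover have "(\<Prod>c\<in>shape f - shape (ext \<nu>). x (glue \<nu> T c))
        = (\<Prod>c\<in>shape f - shape (ext \<nu>). x N)"
      by (intro prod.cong) (auto simp: glue_def)
    moreover have "(\<Prod>c\<in>shape (ext \<nu>). x (glue \<nu> T c)) = (\<Prod>c\<in>shape (ext \<nu>). x (T c))"
      by (intro prod.cong) (auto simp: glue_def)
    moreover have "(\<Prod>c\<in>shape f. x (glue \<nu> T c)) = (\<Prod>c\<in>shape f - shape (ext \<nu>). x (glue \<nu> T c))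
        * (\<Prod>c\<in>shape (ext \<nu>). x (glue \<nu> T c))"
      by (rule prod.subset_diff[OF sub finite_shape[of "Suc N"]]) (rule f0)
    ultimately show ?thesis by simp
  qed
  have "(\<Sum>\<nu>\<in>P. x N ^ (f N + (\<Sum>i<N. f i - \<nu> i)) * schur_poly N x (ext \<nu>))
    = (\<Sum>(\<nu>, T)\<in>(SIGMA \<nu>:P. ssyt N (ext \<nu>)).
        x N ^ (f N + (\<Sum>i<N. f i - \<nu> i)) * (\<Prod>c\<in>shape (ext \<nu>). x (T c)))"
    unfolding schur_poly_def sum_distrib_left
    by (rule sum.Sigma) (use finP finext in auto)
  also have "\<dots> = schur_poly (Suc N) x f"
    unfolding schur_poly_def
  proof (rule sum.reindex_bij_witness[where i = "\<lambda>T. (cut T, restrict T (shape (ext (cut T))))"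
        and j = "\<lambda>(\<nu>, T). glue \<nu> T"], goal_cases)
    case (1 z)
    then obtain \<nu> T where z: "z = (\<nu>, T)" "\<nu> \<in> P" "T \<in> ssyt N (ext \<nu>)" by auto
    have "cut (glue \<nu> T) = \<nu>"
    proof
      fix i show "cut (glue \<nu> T) i = \<nu> i"
        using glue_small[OF z(2,3), of i] PiE_arb[OF z(2)[unfolded P_def], of i]
        by (cases "i < N") (simp_all add: cut_def ext_def)
    qed
    moreover have "restrict (glue \<nu> T) (shape (ext \<nu>)) = T"
      using ssytD(2)[OF z(3)] by (auto simp: fun_eq_iff glue_def restrict_def)
    ultimately show ?case using z by simp
  next
    case (2 z)
    then show ?case using glue by auto
  next
    case (3 T)
    have "glue (cut T) (restrict T (shape (ext (cut T)))) c = T c" for c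
    proof -
      obtain i j where c: "c = (i, j)" by (cases c)
      show ?thesis
        using small_length_iff[OF 3, of j N i] ssytD(1)[OF 3, of j i] ssytD(2)[OF 3, of c]
        by (auto simp: glue_def c ext_cut[OF 3] shape_def)
    qed
    then show ?case by auto
  next
    case (4 T)
    then show ?case using cutP restr by auto
  next
    case (5 z)
    then show ?case using weight by auto
  qed
  finally show ?thesis
    by (simp add: P_def ext_def)
qed

text \<open>Subtracting the staircase \<open>N - Suc i\<close> from \<open>\<beta> i\<close> turns
  the half-open intervals of \<open>alternant_Suc\<close> into the closed ones of
  \<open>schur_poly_Suc\<close>.\<close>

lemma sum_shifted_partitions:
  fixes x :: "nat \<Rightarrow> 'r::comm_ring_1" and N :: nat and f :: "nat \<Rightarrow> nat"
  assumes "antimono f"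
  defines "\<gamma> \<equiv> \<lambda>i. f i + (N - i)"
  shows "(\<Sum>\<beta>\<in>(\<Pi>\<^sub>E i\<in>{..<N}. {\<gamma> (Suc i)..<\<gamma> i}). (\<Prod>i<N. x N ^ (\<gamma> i - 1 - \<beta> i)) * alternant N x \<beta>)
    = (\<Sum>\<nu>\<in>(\<Pi>\<^sub>E i\<in>{..<N}. {f (Suc i)..f i}). x N ^ (\<Sum>i<N. f i - \<nu> i)
        * alternant N x (\<lambda>i. (if i < N then \<nu> i else 0) + (N - Suc i)))"
proof (rule sum.reindex_bij_witness[where i = "\<lambda>\<nu>. \<lambda>i\<in>{..<N}. \<nu> i + (N - Suc i)"
      and j = "\<lambda>\<beta>. \<lambda>i\<in>{..<N}. \<beta> i - (N - Suc i)"], goal_cases)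
  case (1 \<beta>)
  have "N - Suc i \<le> \<beta> i" if "i < N" for i
    using PiE_mem[OF 1, of i] that by (auto simp: \<gamma>_def)
  then have "\<beta> i - (N - Suc i) + (N - Suc i) = \<beta> i" if "i < N" for i
    using that by (simp only: le_add_diff_inverse2)
  with PiE_arb[OF 1] show ?case
    by (simp only: fun_eq_iff restrict_def lessThan_iff split: if_splits) auto
next
  case (2 \<beta>)
  show ?case
  proof (rule restrict_PiE_iff[THEN iffD2], rule ballI)
    fix i assume i: "i \<in> {..<N}"
    then show "\<beta> i - (N - Suc i) \<in> {f (Suc i)..f i}"
      using PiE_mem[OF 2 i] by (auto simp: \<gamma>_def)
  qed
next
  case (3 \<nu>)
  with PiE_arb[OF 3] show ?case by (auto simp: fun_eq_iff restrict_def)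
next
  case (4 \<nu>)
  show ?case
  proof (rule restrict_PiE_iff[THEN iffD2], rule ballI)
    fix i assume i: "i \<in> {..<N}"
    then show "\<nu> i + (N - Suc i) \<in> {\<gamma> (Suc i)..<\<gamma> i}"
      using PiE_mem[OF 4 i] by (auto simp: \<gamma>_def)
  qed
next
  case (5 \<beta>)
  have le: "N - Suc i \<le> \<beta> i" if "i < N" for i
    using PiE_mem[OF 5, of i] that by (auto simp: \<gamma>_def)
  have "(\<Prod>i<N. x N ^ (\<gamma> i - 1 - \<beta> i)) = (\<Prod>i<N. x N ^ (f i - (\<beta> i - (N - Suc i))))"
  proof (intro prod.cong refl arg_cong[of _ _ "power (x N)"])
    fix i assume "i \<in> {..<N}"
    then show "\<gamma> i - 1 - \<beta> i = f i - (\<beta> i - (N - Suc i))"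
      using le[of i] by (simp add: \<gamma>_def)
  qed
  moreover have "alternant N x \<beta> =
     alternant N x (\<lambda>i. (if i < N then restrict (\<lambda>i. \<beta> i - (N - Suc i)) {..<N} i else 0) + (N - Suc i))"
    by (rule alternant_cong) (simp only: restrict_apply lessThan_iff if_True le_add_diff_inverse2[OF le])
  ultimately show ?case
    by (simp add: power_sum)
qed

text \<open>The bialternant formula, by induction on the number of variables: numerator and Schur
  polynomial branch over the same interlacing \<open>\<nu>\<close>.\<close>

theorem alternant_schur_poly:
  fixes x :: "nat \<Rightarrow> 'r::comm_ring_1"
  assumes "antimono f" "f N = 0"
  shows "alternant N x (\<lambda>i. N - Suc i) * schur_poly N x f = alternant N x (\<lambda>i. f i + (N - Suc i))"
  using assms
proof (induction N arbitrary: f)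
  case 0
  have "f i = 0" for i
    using antimonoD[OF 0(1), of 0 i] 0(2) by simp
  then have "f = (\<lambda>_. 0)" by blast
  then have "shape f = {}" "ssyt 0 f = {\<lambda>_. undefined}"
    by (auto simp: shape_def ssyt_def)
  then show ?case
    by (simp add: schur_poly_def alternant_def)
next
  case (Suc N)
  let ?ext = "\<lambda>\<nu> i. if i < N then \<nu> i else 0"
  let ?D = "\<Prod>j<N. x j - x N"
  let ?V = "alternant N x (\<lambda>i. N - Suc i)"
  have Suc_eq: "alternant (Suc N) x (\<lambda>i. g i + (Suc N - Suc i)) = x N ^ g N * ?D *
     (\<Sum>\<nu>\<in>(\<Pi>\<^sub>E i\<in>{..<N}. {g (Suc i)..g i}). x N ^ (\<Sum>i<N. g i - \<nu> i)
        * alternant N x (\<lambda>i. ?ext \<nu> i + (N - Suc i)))" if g: "antimono g" for g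
  proof -
    have "g (Suc i) + (N - Suc i) \<le> g i + (N - i)" for i
      using antimonoD[OF g, of i "Suc i"] by simp
    then have "alternant (Suc N) x (\<lambda>i. g i + (N - i)) = x N ^ (g N + (N - N)) * ?D *
       (\<Sum>\<beta>\<in>(\<Pi>\<^sub>E i\<in>{..<N}. {g (Suc i) + (N - Suc i)..<g i + (N - i)}).
         (\<Prod>i<N. x N ^ (g i + (N - i) - 1 - \<beta> i)) * alternant N x \<beta>)"
      by (rule alternant_Suc[where \<gamma> = "\<lambda>i. g i + (N - i)"])
    then show ?thesis
      unfolding sum_shifted_partitions[OF g] by simp
  qed
  \<comment> \<open>The denominator is the numerator of the empty partition, for which only one
    \<open>\<nu>\<close> interlaces.\<close>
  have V: "alternant (Suc N) x (\<lambda>i. Suc N - Suc i) = ?D * ?V"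
  proof -
    have single: "(\<Pi>\<^sub>E i\<in>{..<N}. {0::nat..0}) = {\<lambda>i\<in>{..<N}. 0}"
      by (auto simp: PiE_iff extensional_def fun_eq_iff restrict_def)
    have "alternant N x (\<lambda>i. ?ext (\<lambda>i\<in>{..<N}. 0) i + (N - Suc i)) = ?V"
      by (rule alternant_cong) simp
    then show ?thesis
      using Suc_eq[of "\<lambda>_. 0", unfolded single] by (simp add: antimono_def)
  qed
  have IH: "?V * schur_poly N x (?ext \<nu>) = alternant N x (\<lambda>i. ?ext \<nu> i + (N - Suc i))"
    if \<nu>: "\<nu> \<in> (\<Pi>\<^sub>E i\<in>{..<N}. {f (Suc i)..f i})" for \<nu>
  proof (rule Suc.IH)
    \<comment> \<open>Within the first \<open>N\<close> rows \<open>f (Suc i)\<close> lies between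
      the two values.\<close>
    have "?ext \<nu> (Suc i) \<le> ?ext \<nu> i" for i
      using PiE_mem[OF \<nu>, of i] PiE_mem[OF \<nu>, of "Suc i"] by auto
    then show "antimono (?ext \<nu>)"
      by (rule decseq_SucI)
  qed simp
  have "?D * ?V * schur_poly (Suc N) x f = x N ^ f N * ?D *
     (\<Sum>\<nu>\<in>(\<Pi>\<^sub>E i\<in>{..<N}. {f (Suc i)..f i}). x N ^ (\<Sum>i<N. f i - \<nu> i)
        * (?V * schur_poly N x (?ext \<nu>)))"
    unfolding schur_poly_Suc[OF Suc.prems] by (simp add: sum_distrib_left power_add mult_ac)
  also have "\<dots> = alternant (Suc N) x (\<lambda>i. f i + (Suc N - Suc i))"
    by (simp only: Suc_eq[OF Suc.prems(1)] IH cong: sum.cong)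
  finally show ?case by (simp only: V)
qed

section \<open>Restriction to finitely many variables\<close>

definition monomial :: "(nat \<Rightarrow>\<^sub>0 nat) \<Rightarrow> 'a::comm_ring_1 mfps" where
  "monomial a = Abs_mfps (\<lambda>m. if m = a then 1 else 0)"

lemma mcoeff_monomial: "mcoeff (monomial a) m = (if m = a then 1 else 0)"
  by (simp add: monomial_def Abs_mfps_inverse)

definition var :: "nat \<Rightarrow> 'a::comm_ring_1 mfps" where
  "var v = monomial (Poly_Mapping.single v 1)"

lemma mcoeff_sum: "mcoeff (sum f A) m = (\<Sum>i\<in>A. mcoeff (f i) m)"
  by (induction A rule: infinite_finite_induct) (simp_all add: zero_mfps.rep_eq plus_mfps.rep_eq)

lemma monomial_mult: "monomial a * monomial b = (monomial (a + b) :: 'a::comm_ring_1 mfps)"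
proof (rule mfps_eqI)
  fix m
  have "mcoeff (monomial a * monomial b :: 'a mfps) m
      = (\<Sum>z\<in>splits m. if z = (a, b) then 1 else 0)"
    unfolding times_mfps.rep_eq mcoeff_monomial by (intro sum.cong) (auto split: if_splits)
  also have "\<dots> = mcoeff (monomial (a + b)) m"
    by (simp add: finite_splits mcoeff_monomial) (auto simp: splits_def)
  finally show "mcoeff (monomial a * monomial b :: 'a mfps) m = mcoeff (monomial (a + b)) m" .
qed

lemma monomial_0: "monomial 0 = 1"
  by (rule mfps_eqI) (simp add: mcoeff_monomial one_mfps.rep_eq)

lemma monomial_sum: "(\<Prod>i\<in>A. monomial (f i)) = monomial (\<Sum>i\<in>A. f i)"
  by (induction A rule: infinite_finite_induct) (simp_all add: monomial_0 monomial_mult)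

lemma var_power: "var v ^ k = monomial (Poly_Mapping.single v k)"
  by (induction k) (simp_all add: var_def monomial_0 monomial_mult flip: single_add)

lemma mcoeff_var_power_mult:
  assumes "Poly_Mapping.lookup m v < k"
  shows "mcoeff (var v ^ k * g) m = 0"
proof -
  have "mcoeff (monomial (Poly_Mapping.single v k)) a * mcoeff g b = 0" if "a + b = m" for a b
    using assms that by (auto simp: mcoeff_monomial lookup_add)
  then show ?thesis
    unfolding var_power times_mfps.rep_eq by (intro sum.neutral) (auto simp: splits_def)
qed

lemma mcoeff_pow_ideal:
  assumes "y \<in> pow_ideal N K var" "\<And>v. v < N \<Longrightarrow> Poly_Mapping.lookup m v < K"
  shows "mcoeff y m = 0"
  using assms by (auto simp: pow_ideal_def mcoeff_sum mcoeff_var_power_mult)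

text \<open>This sets the variables from \<open>N\<close> on to \<open>0\<close>; the lemmas below
  show that it respects sums and products.\<close>

lift_definition truncate :: "nat \<Rightarrow> 'a::comm_ring_1 mfps \<Rightarrow> 'a mfps"
  is "\<lambda>N f m. if Poly_Mapping.keys m \<subseteq> {..<N} then f m else 0" .

lemma truncate_0: "truncate N 0 = 0"
  by (rule mfps_eqI) (simp add: truncate.rep_eq zero_mfps.rep_eq)

lemma truncate_1: "truncate N 1 = 1"
  by (rule mfps_eqI) (simp add: truncate.rep_eq one_mfps.rep_eq)

lemma truncate_add: "truncate N (f + g) = truncate N f + truncate N g"
  by (rule mfps_eqI) (simp add: truncate.rep_eq plus_mfps.rep_eq)

lemma truncate_sum: "truncate N (sum f A) = (\<Sum>i\<in>A. truncate N (f i))"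
  by (induction A rule: infinite_finite_induct) (simp_all add: truncate_0 truncate_add)

lemma truncate_mult: "truncate N (f * g) = truncate N f * truncate N g"
proof (rule mfps_eqI)
  fix m
  have keys: "Poly_Mapping.keys (a + b) = Poly_Mapping.keys a \<union> Poly_Mapping.keys b" for a b :: "nat \<Rightarrow>\<^sub>0 nat"
    by (auto simp: in_keys_iff lookup_add)
  show "mcoeff (truncate N (f * g)) m = mcoeff (truncate N f * truncate N g) m"
  proof (cases "Poly_Mapping.keys m \<subseteq> {..<N}")
    case True
    have "mcoeff (truncate N f) a * mcoeff (truncate N g) b = mcoeff f a * mcoeff g b"
      if "a + b = m" for a b
      using True keys[of a b] that by (simp add: truncate.rep_eq)
    then have "(\<Sum>(a, b)\<in>splits m. mcoeff (truncate N f) a * mcoeff (truncate N g) b)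
        = (\<Sum>(a, b)\<in>splits m. mcoeff f a * mcoeff g b)"
      by (intro sum.cong) (auto simp: splits_def)
    with True show ?thesis
      by (simp add: truncate.rep_eq[of _ "f * g"] times_mfps.rep_eq)
  next
    case False
    have "mcoeff (truncate N f) a * mcoeff (truncate N g) b = 0" if "a + b = m" for a b
      using False keys[of a b] that by (auto simp: truncate.rep_eq)
    then have "(\<Sum>(a, b)\<in>splits m. mcoeff (truncate N f) a * mcoeff (truncate N g) b) = 0"
      by (intro sum.neutral) (auto simp: splits_def)
    with False show ?thesis
      by (simp add: truncate.rep_eq[of _ "f * g"] times_mfps.rep_eq)
  qed
qed

lemma truncate_prod: "truncate N (prod f A) = (\<Prod>i\<in>A. truncate N (f i))"
  by (induction A rule: infinite_finite_induct) (simp_all add: truncate_1 truncate_mult)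

lemma truncate_const_mult: "truncate N (mfps_const c * f) = mfps_const c * truncate N f"
  by (rule mfps_eqI) (simp add: truncate.rep_eq mcoeff_const_mult)

lemma truncate_power_sum:
  assumes "r > 0"
  shows "truncate N (power_sum r) = (\<Sum>v<N. var v ^ r :: 'a::comm_ring_1 mfps)"
proof (rule mfps_eqI)
  fix m
  have R: "mcoeff (\<Sum>v<N. var v ^ r :: 'a mfps) m = (\<Sum>v<N. if m = Poly_Mapping.single v r then 1 else 0)"
    by (simp add: mcoeff_sum var_power mcoeff_monomial)
  show "mcoeff (truncate N (power_sum r)) m = mcoeff (\<Sum>v<N. var v ^ r :: 'a mfps) m"
  proof (cases "\<exists>i. m = Poly_Mapping.single i r")
    case True
    then obtain i where i: "m = Poly_Mapping.single i r" by blast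
    \<comment> \<open>This needs \<open>r > 0\<close>: for \<open>r = 0\<close> these monomials all
      coincide.\<close>
    have "Poly_Mapping.single i r = Poly_Mapping.single v r \<longleftrightarrow> v = i" for v
      using assms by (metis lookup_single_eq lookup_single_not_eq less_irrefl)
    then show ?thesis
      using assms True unfolding R by (simp add: i truncate.rep_eq power_sum.rep_eq)
  next
    case False
    then show ?thesis
      unfolding R by (simp add: truncate.rep_eq power_sum.rep_eq)
  qed
qed

definition part :: "nat list \<Rightarrow> nat \<Rightarrow> nat" where
  "part \<mu> i = (if i < length \<mu> then \<mu> ! i else 0)"

lemma young_diagram_eq_shape: "young_diagram \<mu> = shape (part \<mu>)"
  by (auto simp: young_diagram_def shape_def part_def split: if_splits)

lemma keys_tableau_content: "Poly_Mapping.keys (tableau_content \<mu> T) = T ` young_diagram \<mu>"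
proof -
  have "v \<in> Poly_Mapping.keys (tableau_content \<mu> T) \<longleftrightarrow> v \<in> T ` young_diagram \<mu>" for v
    using finite_young_diagram[of \<mu>]
    by (auto simp: in_keys_iff tableau_content_def lookup_sum lookup_single when_def)
  then show ?thesis by blast
qed

text \<open>The entries of a tableau lie below \<open>N\<close> exactly if its content involves only
  the first \<open>N\<close> variables.\<close>

lemma truncate_schur: "truncate N (schur \<mu>) = (schur_poly N var (part \<mu>) :: 'a::comm_ring_1 mfps)"
proof (rule mfps_eqI)
  fix m
  have fin: "finite (ssyt N (part \<mu>))"
    by (rule finite_ssyt[of "length \<mu>"]) (simp add: part_def)
  have "mcoeff (schur_poly N var (part \<mu>) :: 'a mfps) m
    = (\<Sum>T\<in>ssyt N (part \<mu>). if m = tableau_content \<mu> T then 1 else 0)"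
    by (simp add: schur_poly_def var_def mcoeff_sum monomial_sum mcoeff_monomial tableau_content_def young_diagram_eq_shape)
  also have "\<dots> = of_nat (card {T \<in> ssyt N (part \<mu>). tableau_content \<mu> T = m})"
    using fin by (simp add: sum.If_cases Int_def eq_commute)
  also have "{T \<in> ssyt N (part \<mu>). tableau_content \<mu> T = m}
    = (if Poly_Mapping.keys m \<subseteq> {..<N} then {T \<in> semistandard_tableaux \<mu>. tableau_content \<mu> T = m} else {})"
  proof -
    have "T \<in> ssyt N (part \<mu>) \<longleftrightarrow> T \<in> semistandard_tableaux \<mu>
        \<and> Poly_Mapping.keys (tableau_content \<mu> T) \<subseteq> {..<N}" for T
      unfolding keys_tableau_content ssyt_def semistandard_tableaux_def young_diagram_eq_shape
      by (auto simp: shape_def PiE_def Pi_def extensional_def image_subset_iff)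
    then show ?thesis by auto
  qed
  finally show "mcoeff (truncate N (schur \<mu>)) m = mcoeff (schur_poly N var (part \<mu>) :: 'a mfps) m"
    by (simp add: truncate.rep_eq schur.rep_eq)
qed

text \<open>The exponent vectors in the alternant are the rearrangements of \<open>\<gamma>\<close>,
  and a strictly decreasing sequence has only one decreasing rearrangement.\<close>

lemma mcoeff_alternant:
  fixes \<gamma> \<gamma>' :: "nat \<Rightarrow> nat"
  assumes dec: "\<And>i j. i < j \<Longrightarrow> j < N \<Longrightarrow> \<gamma> j < \<gamma> i" "\<And>i j. i < j \<Longrightarrow> j < N \<Longrightarrow> \<gamma>' j < \<gamma>' i"
  shows "mcoeff (alternant N var \<gamma> :: 'a::comm_ring_1 mfps) (\<Sum>i<N. Poly_Mapping.single i (\<gamma>' i))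
    = of_bool (\<forall>i<N. \<gamma> i = \<gamma>' i)"
proof -
  let ?m = "\<Sum>i<N. Poly_Mapping.single i (\<gamma>' i)"
  let ?P = "{p. p permutes {0..<N}}"
  have look: "Poly_Mapping.lookup ?m i = \<gamma>' i" if "i < N" for i
    using that by (simp add: lookup_sum lookup_single when_def)
  have sgn: "mcoeff (of_int (sign p) * y :: 'a mfps) m = of_int (sign p) * mcoeff y m" for p y m
    by (simp add: sign_def uminus_mfps.rep_eq)
  have "alternant N var \<gamma> = (\<Sum>p\<in>?P. of_int (sign p) * (\<Prod>i = 0..<N. (var (p i) :: 'a mfps) ^ \<gamma> i))"
    unfolding alternant_def by (subst det_def'[where n = N])
      (auto intro!: sum.cong prod.cong arg_cong2[of _ _ _ _ "(*)"] simp: permutes_in_image)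
  then have "alternant N var \<gamma>
    = (\<Sum>p\<in>?P. of_int (sign p) * (monomial (\<Sum>i<N. Poly_Mapping.single (p i) (\<gamma> i)) :: 'a mfps))"
    by (simp add: var_power monomial_sum lessThan_atLeast0)
  then have "mcoeff (alternant N var \<gamma> :: 'a mfps) ?m
    = (\<Sum>p\<in>?P. of_int (sign p) * (if ?m = (\<Sum>i<N. Poly_Mapping.single (p i) (\<gamma> i)) then 1 else 0))"
    by (simp only: mcoeff_sum sgn mcoeff_monomial)
  also have "\<dots> = (\<Sum>p\<in>?P. if p = id then of_bool (\<forall>i<N. \<gamma> i = \<gamma>' i) else 0)"
  proof (rule sum.cong[OF refl])
    fix p assume "p \<in> ?P"
    then have p: "p permutes {0..<N}" by simp
    let ?m' = "\<Sum>i<N. Poly_Mapping.single (p i) (\<gamma> i)"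
    have pN: "p i < N" if "i < N" for i
      using permutes_in_image[OF p, of i] that by simp
    have inj: "p i = p j \<longleftrightarrow> i = j" for i j
      using permutes_inj[OF p] by (auto dest: injD)
    have look': "Poly_Mapping.lookup ?m' (p i) = \<gamma> i" if "i < N" for i
      using that by (simp add: lookup_sum lookup_single when_def inj)
    show "of_int (sign p) * (if ?m = ?m' then 1 else 0) = (if p = id then of_bool (\<forall>i<N. \<gamma> i = \<gamma>' i) else (0::'a))"
    proof (cases "p = id")
      case True
      have "?m = ?m' \<longleftrightarrow> (\<forall>i<N. \<gamma> i = \<gamma>' i)"
      proof
        assume "?m = ?m'"
        then show "\<forall>i<N. \<gamma> i = \<gamma>' i"
          using look look' True by (metis id_apply)
      next
        assume "\<forall>i<N. \<gamma> i = \<gamma>' i"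
        then show "?m = ?m'"
          using True by (intro sum.cong) simp_all
      qed
      then show ?thesis using True by simp
    next
      case False
      have "?m \<noteq> ?m'"
      proof
        assume eq: "?m = ?m'"
        have \<gamma>: "\<gamma>' (p i) = \<gamma> i" if "i < N" for i
          using look[OF pN[OF that]] look'[OF that] eq by simp
        \<comment> \<open>A permutation that matches two decreasing sequences is increasing, hence
          the identity.\<close>
        have mono: "p i < p j" if "i < j" "j < N" for i j
        proof (rule ccontr)
          assume "\<not> p i < p j"
          then have "p j < p i" using inj[of i j] that by linarith
          then have "\<gamma>' (p i) < \<gamma>' (p j)" using dec(2) pN[of i] that by simp
          with dec(1)[OF that] show False using \<gamma> that by simp
        qed
        have "i \<le> p i" if "i < N" for i
          using that
        proof (induction i)
          case (Suc i)
          then show ?case using mono[of i "Suc i"] by simp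
        qed simp
        then have "p = id"
          by (intro permutes_natset_ge[OF p]) auto
        with False show False ..
      qed
      with False show ?thesis by simp
    qed
  qed
  also have "\<dots> = of_bool (\<forall>i<N. \<gamma> i = \<gamma>' i)"
    by (simp add: finite_permutations permutes_id)
  finally show ?thesis .
qed

section \<open>Cycle types and atomic symmetric functions\<close>

lemma orbit_eq:
  assumes "w permutes X" "finite X" "j \<in> orbit w i"
  shows "orbit w j = orbit w i"
  using cyclic_on_orbit[OF assms(1,2), of i] assms(3) by (simp add: cyclic_on_alldef)

lemma orbit_self:
  assumes "w permutes X" "finite X"
  shows "i \<in> orbit w i"
  using assms by (intro permutation_self_in_orbit) (auto simp: permutation_permutes)

lemma orbit_fibre:
  assumes "w permutes X" "finite X" "i \<in> X"
  shows "{j \<in> X. orbit w j = orbit w i} = orbit w i"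
  using orbit_eq[OF assms(1,2)] orbit_self[OF assms(1,2)] permutes_orbit_subset[OF assms(1,3)] by blast

lemma invariant_on_orbit:
  assumes "w permutes X" "\<And>i. i \<in> X \<Longrightarrow> c (w i) = c i" "i \<in> X" "j \<in> orbit w i"
  shows "c j = c i"
proof -
  have "j \<in> X \<and> c j = c i"
    using assms(4)
  proof induction
    case base
    then show ?case using assms permutes_in_image[OF assms(1)] by simp
  next
    case (step y)
    then show ?case using assms(2)[of y] permutes_in_image[OF assms(1)] by simp
  qed
  then show ?thesis ..
qed

text \<open>A colouring constant on cycles amounts to one colour per orbit, and an orbit
  \<open>C\<close> of colour \<open>v\<close> contributes \<open>x v ^ card C\<close>.\<close>

lemma cycle_weight_eq_prod_orbits:
  fixes x :: "nat \<Rightarrow> 'r::comm_ring_1"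
  assumes w: "w permutes X" and X: "finite X"
  shows "cycle_weight N x X (\<lambda>_. 1) w = (\<Prod>C\<in>orbit w ` X. \<Sum>v<N. x v ^ card C)"
proof -
  let ?C = "orbit w ` X"
  let ?lift = "\<lambda>g. \<lambda>i\<in>X. g (orbit w i) :: nat"
  define rep where "rep C = (SOME i. i \<in> X \<and> orbit w i = C)" for C
  have rep: "rep C \<in> X" "orbit w (rep C) = C" if "C \<in> ?C" for C
    using someI_ex[of "\<lambda>i. i \<in> X \<and> orbit w i = C"] that unfolding rep_def by auto
  have wX: "w i \<in> X \<longleftrightarrow> i \<in> X" for i
    using permutes_in_image[OF w] .
  have step: "orbit w (w i) = orbit w i" for i
    by (rule orbit_eq[OF w X orbit.base])
  have "(\<Prod>C\<in>?C. \<Sum>v<N. x v ^ card C) = (\<Sum>g\<in>?C \<rightarrow>\<^sub>E {..<N}. \<Prod>C\<in>?C. x (g C) ^ card C)"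
    using X by (intro prod_sum_PiE) auto
  also have "\<dots> = cycle_weight N x X (\<lambda>_. 1) w"
    unfolding cycle_weight_def
  proof (rule sum.reindex_bij_witness[where j = ?lift and i = "\<lambda>c. \<lambda>C\<in>?C. c (rep C)"], goal_cases)
    case (1 g)
    show ?case
    proof
      fix C
      show "(\<lambda>C\<in>?C. ?lift g (rep C)) C = g C"
        using rep[of C] PiE_arb[OF 1, of C] by (cases "C \<in> ?C") simp_all
    qed
  next
    case (2 g)
    then show ?case
      by (auto simp: step wX PiE_iff)
  next
    case (3 c)
    then have c: "c \<in> X \<rightarrow>\<^sub>E {..<N}" "\<And>i. i \<in> X \<Longrightarrow> c (w i) = c i" by auto
    show ?case
    proof
      fix i
      show "?lift (\<lambda>C\<in>?C. c (rep C)) i = c i"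
      proof (cases "i \<in> X")
        case True
        then have "rep (orbit w i) \<in> orbit w i" "orbit w i \<in> ?C"
          using rep[of "orbit w i"] orbit_self[OF w X, of "rep (orbit w i)"] by auto
        then show ?thesis
          using True c(2) invariant_on_orbit[OF w _ True, of c "rep (orbit w i)"] by simp
      next
        case False
        then show ?thesis using PiE_arb[OF c(1)] by simp
      qed
    qed
  next
    case (4 c)
    then have "c i < N" if "i \<in> X" for i using that by (auto simp: PiE_iff)
    then show ?case using rep by simp
  next
    case (5 g)
    have "(\<Prod>i\<in>X. x (?lift g i) ^ 1) = (\<Prod>C\<in>?C. \<Prod>i | i \<in> X \<and> orbit w i = C. x (?lift g i) ^ 1)"
      by (rule prod.image_gen[OF X])
    also have "\<dots> = (\<Prod>C\<in>?C. \<Prod>i\<in>C. x (g C))"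
    proof (rule prod.cong[OF refl])
      fix C assume "C \<in> ?C"
      then have fibre: "{i \<in> X. orbit w i = C} = C"
        using orbit_fibre[OF w X] by auto
      show "(\<Prod>i | i \<in> X \<and> orbit w i = C. x (?lift g i) ^ 1) = (\<Prod>i\<in>C. x (g C))"
        by (rule prod.cong[OF fibre]) (use fibre in auto)
    qed
    finally show ?case by simp
  qed
  finally show ?thesis ..
qed

lemma power_sum_partition_cycle_type:
  "power_sum_partition (cycle_type n w) = (\<Prod>C\<in>orbit w ` {1..n}. power_sum (card C))"
proof -
  have "power_sum_partition (cycle_type n w)
    = prod_mset (mset (map power_sum (cycle_type n w)))"
    by (simp only: power_sum_partition_def prod_mset_prod_list)
  then show ?thesis
    by (simp add: cycle_type_def prod_unfold_prod_mset image_mset.compositionality comp_def)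
qed

lemma truncate_power_sum_partition_cycle_type:
  assumes "w permutes {1..n}"
  shows "truncate N (power_sum_partition (cycle_type n w))
    = (cycle_weight N var {1..n} (\<lambda>_. 1) w :: 'a::comm_ring_1 mfps)"
proof -
  have "card C > 0" if "C \<in> orbit w ` {1..n}" for C
  proof -
    from that obtain i where i: "i \<in> {1..n}" "C = orbit w i" by auto
    then have "finite C"
      using permutes_orbit_subset[OF assms] finite_subset by blast
    then show ?thesis
      using i orbit_nonempty[of w i] by (simp add: card_gt_0_iff)
  qed
  then show ?thesis
    unfolding power_sum_partition_cycle_type truncate_prod
      cycle_weight_eq_prod_orbits[OF assms finite_atLeastAtMost]
    by (intro prod.cong refl truncate_power_sum)
qed

text \<open>This ensures that grouping by cycle type in \<open>atomic\<close> reaches every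
  permutation.\<close>

lemma cycle_type_in_int_partitions:
  assumes w: "w permutes {1..n}"
  shows "cycle_type n w \<in> int_partitions n"
proof -
  let ?X = "{1..n}"
  let ?C = "orbit w ` ?X"
  have fin: "finite (orbit w i)" if "i \<in> ?X" for i
    using permutes_orbit_subset[OF w that] finite_subset by blast
  have "sorted_wrt (\<ge>) (cycle_type n w)"
    by (simp add: cycle_type_def sorted_wrt_rev)
  moreover have "0 \<notin> set (cycle_type n w)"
    using fin orbit_nonempty[of w] by (auto simp: cycle_type_def)
  moreover have "sum_list (cycle_type n w) = n"
  proof -
    have "sum_list (cycle_type n w) = (\<Sum>C\<in>?C. card C)"
      by (simp add: cycle_type_def sum_list_rev sum_unfold_sum_mset flip: sum_mset_sum_list)
    also have "\<dots> = (\<Sum>C\<in>?C. \<Sum>i | i \<in> ?X \<and> orbit w i = C. 1)"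
      using orbit_fibre[OF w] by (intro sum.cong refl) auto
    also have "\<dots> = (\<Sum>i\<in>?X. 1)"
      by (rule sum.image_gen[symmetric]) simp
    finally show ?thesis by simp
  qed
  ultimately show ?thesis by (simp add: int_partitions_def)
qed

text \<open>Undoing the grouping by cycle type leaves one power sum product per permutation, and
  each becomes a \<open>cycle_weight\<close>.\<close>

lemma truncate_atomic:
  "truncate N (atomic n I J) = (atomic_sum N var {1..n} I J (\<lambda>_. 1) :: 'a::comm_ring_1 mfps)"
proof -
  let ?W = "{w. w permutes {1..n} \<and> map w I = J}"
  have fin: "finite ?W"
    using finite_permutations[of "{1..n}"] by simp
  have "atomic n I J = (\<Sum>\<mu>\<in>int_partitions n. \<Sum>w | w \<in> ?W \<and> cycle_type n w = \<mu>.
      power_sum_partition (cycle_type n w) :: 'a mfps)"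
    unfolding atomic_def
  proof (rule sum.cong[OF refl])
    fix \<mu>
    have "{w. w permutes {1..n} \<and> cycle_type n w = \<mu> \<and> map w I = J} = {w. w \<in> ?W \<and> cycle_type n w = \<mu>}"
      by auto
    then show "of_nat (card {w. w permutes {1..n} \<and> cycle_type n w = \<mu> \<and> map w I = J}) * power_sum_partition \<mu>
      = (\<Sum>w | w \<in> ?W \<and> cycle_type n w = \<mu>. power_sum_partition (cycle_type n w) :: 'a mfps)"
      by simp
  qed
  also have "\<dots> = (\<Sum>w\<in>?W. power_sum_partition (cycle_type n w))"
    using cycle_type_in_int_partitions by (intro sum.group fin finite_int_partitions) auto
  finally have "truncate N (atomic n I J)
    = (\<Sum>w\<in>?W. truncate N (power_sum_partition (cycle_type n w)) :: 'a mfps)"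
    by (simp add: truncate_sum)
  then show ?thesis
    by (simp add: atomic_sum_def truncate_power_sum_partition_cycle_type)
qed

section \<open>Partitions as exponent vectors and the comparison of coefficients\<close>

lemma length_int_partition:
  assumes "\<mu> \<in> int_partitions n"
  shows "length \<mu> \<le> n"
proof -
  have "length xs \<le> sum_list xs" if "0 \<notin> set xs" for xs :: "nat list"
    using that by (induction xs) auto
  then show ?thesis using assms by (auto simp: int_partitions_def)
qed

lemma antimono_part:
  assumes "\<mu> \<in> int_partitions n"
  shows "antimono (part \<mu>)"
proof (rule antimonoI)
  fix i j :: nat assume "i \<le> j"
  then show "part \<mu> j \<le> part \<mu> i"
    using assms by (cases "i = j") (auto simp: part_def int_partitions_def sorted_wrt_iff_nth_less)
qed

text \<open>All parts are positive, so the padding by \<open>0\<close> reveals the length, which is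
  at most \<open>n\<close>.\<close>

lemma part_inject:
  assumes "\<mu> \<in> int_partitions n" "\<nu> \<in> int_partitions n" "\<And>i. i < n \<Longrightarrow> part \<mu> i = part \<nu> i"
  shows "\<mu> = \<nu>"
proof -
  have pos: "i < length \<mu> \<longleftrightarrow> 0 < part \<mu> i" if "\<mu> \<in> int_partitions n" for \<mu> i
  proof (cases "i < length \<mu>")
    case True
    have "0 \<notin> set \<mu>"
      using that by (simp add: int_partitions_def)
    then have "\<mu> ! i \<noteq> 0"
      using nth_mem[OF True] \<open>0 \<notin> set \<mu>\<close> by metis
    with True show ?thesis by (simp add: part_def)
  qed (simp add: part_def)
  have eq: "part \<mu> i = part \<nu> i" for i
    using assms(3) length_int_partition[OF assms(1)] length_int_partition[OF assms(2)]
    by (cases "i < n") (auto simp: part_def)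
  then have "i < length \<mu> \<longleftrightarrow> i < length \<nu>" for i
    using pos assms by simp
  then have len: "length \<mu> = length \<nu>"
    by (meson linorder_neq_iff less_irrefl)
  show ?thesis
  proof (rule nth_equalityI[OF len])
    fix i assume "i < length \<mu>"
    then show "\<mu> ! i = \<nu> ! i" using eq[of i] len by (simp add: part_def)
  qed
qed

text \<open>Reversing the rows costs only a sign. It links the increasing exponents of the stack
  bases with the decreasing staircase of the bialternant formula.\<close>

lemma alternant_reverse:
  "\<exists>s. alternant N x (\<lambda>i. N - Suc i) = s * alternant N x (\<lambda>i. i)"
proof -
  define p where "p i = (if i < N then N - Suc i else i)" for i
  have "p permutes {0..<N}"
    by (rule bij_imp_permutes) (auto simp: p_def intro!: bij_betw_byWitness[where f' = p])
  from det_permute_rows[OF _ this, of "mat N N (\<lambda>(i, j). x j ^ i)"]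
  have "det (mat N N (\<lambda>(i, j). mat N N (\<lambda>(i, j). x j ^ i) $$ (p i, j)))
    = of_int (sign p) * alternant N x (\<lambda>i. i)"
    by (simp add: alternant_def)
  moreover have "mat N N (\<lambda>(i, j). mat N N (\<lambda>(i, j). x j ^ i) $$ (p i, j))
    = mat N N (\<lambda>(i, j). x j ^ (N - Suc i))"
    by (rule eq_matI) (auto simp: p_def)
  ultimately show ?thesis
    by (metis alternant_def)
qed

theorem theorem4p6:
  fixes n k :: nat and I J :: "nat list" and b :: "nat list \<Rightarrow> 'a::field_char_0"
  assumes "(I, J) \<in> partial_permutations n k"
    and "atomic n I J = (\<Sum>\<mu>\<in>int_partitions n. mfps_const (b \<mu>) * schur \<mu>)"
    and "\<mu> \<in> int_partitions n"
    and "\<not> first_part \<mu> \<ge> n - k"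
  shows "b \<mu> = 0"
proof -
  \<comment> \<open>The bound of \<open>atomic_sum_in_pow_ideal\<close> for \<open>N = n\<close> and
    \<open>m = n - k\<close>; the last assumption forces \<open>m > 0\<close>.\<close>
  define K where "K = n + (n - k) - 1"
  define V where "V = (alternant n var (\<lambda>i. n - Suc i) :: 'a mfps)"
  define A where "A = (atomic_sum n var {1..n} I J (\<lambda>_. 1) :: 'a mfps)"
  \<comment> \<open>The exponent of \<open>x\<^sup>e\<close> is that of the diagonal term of the
    alternant for \<open>\<mu>\<close>; among the alternants of partitions of \<open>n\<close>, no
    other contains this monomial.\<close>
  define e where "e = (\<Sum>i<n. Poly_Mapping.single i (part \<mu> i + (n - Suc i)))"
  have "alternant n var (\<lambda>i. i) * A \<in> pow_ideal n K var"
    unfolding A_def K_def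
    using assms(1,4) by (intro atomic_sum_in_pow_ideal) (auto simp: partial_permutations_def)
  moreover obtain s where "V = s * alternant n var (\<lambda>i. i)"
    using alternant_reverse[of n "var :: nat \<Rightarrow> 'a mfps"] by (auto simp: V_def)
  ultimately have VA: "V * A \<in> pow_ideal n K var"
    using pow_ideal_mult[of "alternant n var (\<lambda>i. i) * A" n K var s] by (simp add: mult.assoc)
  \<comment> \<open>Each exponent is at most \<open>first_part \<mu> + (n - 1)\<close>, and
    \<open>first_part \<mu> < n - k\<close>.\<close>
  have "Poly_Mapping.lookup e v < K" if "v < n" for v
  proof -
    have "part \<mu> v \<le> first_part \<mu>"
      using antimonoD[OF antimono_part[OF assms(3)], of 0 v]
      by (auto simp: part_def first_part_def split: list.splits if_splits)
    moreover have "Poly_Mapping.lookup e v = part \<mu> v + (n - Suc v)"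
      using that by (simp add: e_def lookup_sum lookup_single when_def)
    ultimately show ?thesis
      using assms(4) that by (simp add: K_def)
  qed
  then have "mcoeff (V * A) e = 0"
    using mcoeff_pow_ideal[OF VA] by blast
  have dec: "part \<nu> j + (n - Suc j) < part \<nu> i + (n - Suc i)"
    if "\<nu> \<in> int_partitions n" "i < j" "j < n" for \<nu> i j
    using antimonoD[OF antimono_part[OF that(1)], of i j] that by simp
  \<comment> \<open>Restricting to \<open>n\<close> variables keeps the partitions apart, as none of
    them has more than \<open>n\<close> parts.\<close>
  have "A = (\<Sum>\<nu>\<in>int_partitions n. mfps_const (b \<nu>) * schur_poly n var (part \<nu>))"
    using arg_cong[OF assms(2), of "truncate n"]
    by (simp add: A_def truncate_atomic truncate_sum truncate_const_mult truncate_schur)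
  then have "V * A = (\<Sum>\<nu>\<in>int_partitions n. mfps_const (b \<nu>) * (V * schur_poly n var (part \<nu>)))"
    by (simp add: sum_distrib_left mult.left_commute)
  also have "\<dots> = (\<Sum>\<nu>\<in>int_partitions n. mfps_const (b \<nu>)
      * alternant n var (\<lambda>i. part \<nu> i + (n - Suc i)))"
  proof (rule sum.cong[OF refl])
    fix \<nu> assume \<nu>: "\<nu> \<in> int_partitions n"
    then have "part \<nu> n = 0"
      using length_int_partition[OF \<nu>] by (simp add: part_def)
    then show "mfps_const (b \<nu>) * (V * schur_poly n var (part \<nu>))
      = mfps_const (b \<nu>) * alternant n var (\<lambda>i. part \<nu> i + (n - Suc i))"
      by (simp add: V_def alternant_schur_poly antimono_part[OF \<nu>])
  qed
  finally have "mcoeff (V * A) e = (\<Sum>\<nu>\<in>int_partitions n. b \<nu> *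
      mcoeff (alternant n var (\<lambda>i. part \<nu> i + (n - Suc i))) e)"
    by (simp add: mcoeff_sum mcoeff_const_mult)
  also have "\<dots> = (\<Sum>\<nu>\<in>int_partitions n. if \<nu> = \<mu> then b \<mu> else 0)"
  proof (rule sum.cong[OF refl])
    fix \<nu> assume \<nu>: "\<nu> \<in> int_partitions n"
    have "(\<forall>i<n. part \<nu> i + (n - Suc i) = part \<mu> i + (n - Suc i)) \<longleftrightarrow> \<nu> = \<mu>"
      unfolding add_right_cancel using part_inject[OF \<nu> assms(3)] by blast
    then show "b \<nu> * mcoeff (alternant n var (\<lambda>i. part \<nu> i + (n - Suc i))) e
      = (if \<nu> = \<mu> then b \<mu> else 0)"
      unfolding e_def by (subst mcoeff_alternant[OF dec[OF \<nu>] dec[OF assms(3)]]) auto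
  qed
  also have "\<dots> = b \<mu>"
    using assms(3) by (simp add: finite_int_partitions)
  finally show ?thesis
    using \<open>mcoeff (V * A) e = 0\<close> by simp
qed

end
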